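(* Let $H$ be an $n\times n$ Hermitian matrix and let $M=H+aJ$, where $a$ is a real number and $J$ is the $n\times n$ all-ones matrix. Let $\tau_1<\tau_2<\cdots<\tau_r$ be the distinct main eigenvalues of $H$, let $\beta_i$ be the main angle of $\tau_i$ (as an eigenvalue of $H$), and let $\mu_1<\mu_2<\cdots<\mu_s$ be the distinct main eigenvalues of $M$. Then $r=s$, and \[ \prod_{i=1}^r(\mu_i-x)=\prod_{i=1}^r(\tau_i-x)\Big(1+a\sum_{j=1}^r\frac{n\beta_j^2}{\tau_j-x}\Big). \] Moreover, if $a>0$ then $\tau_1<\mu_1<\tau_2<\mu_2<\cdots<\tau_r<\mu_r$, and if $a<0$ then $\mu_1<\tau_1<\mu_2<\tau_2<\cdots<\mu_r<\tau_r$.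
   Context: For an $n\times n$ Hermitian matrix $H$ with distinct eigenvalues $\theta_1<\cdots<\theta_t$, let $E_i$ be the orthogonal projection onto the eigenspace of $\theta_i$ and let $j$ be the all-ones column vector of length $n$. The main angle of $\theta_i$ is $\beta_i=\frac{1}{\sqrt n}\sqrt{(E_ij)^*(E_ij)}$, where $^*$ denotes conjugate transpose. The eigenvalue $\theta_i$ is called main if $\beta_i\neq 0$. *)

theory Defs
  imports "Jordan_Normal_Form.Matrix" "Jordan_Normal_Form.Char_Poly"
begin

(* conjugate transpose A^* *)
definition ctrans :: "complex mat \<Rightarrow> complex mat" where
  "ctrans A = mat (dim_col A) (dim_row A) (\<lambda>(i,j). cnj (A $$ (j,i)))"

definition hermitian_mat :: "nat \<Rightarrow> complex mat \<Rightarrow> bool" where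
  "hermitian_mat n H \<longleftrightarrow> H \<in> carrier_mat n n \<and> ctrans H = H"

(* the all-ones column vector j and the all-ones matrix J *)
definition ones_vec :: "nat \<Rightarrow> complex vec" where
  "ones_vec n = vec n (\<lambda>_. 1)"

definition ones_mat :: "nat \<Rightarrow> complex mat" where
  "ones_mat n = mat n n (\<lambda>_. 1)"

(* eigenspace of H for theta *)
definition eigenspace :: "nat \<Rightarrow> complex mat \<Rightarrow> complex \<Rightarrow> complex vec set" where
  "eigenspace n H \<theta> = {v \<in> carrier_vec n. H *\<^sub>v v = \<theta> \<cdot>\<^sub>v v}"

(* orthogonal projection onto the eigenspace: the unique Hermitian idempotent
   n x n matrix whose range is the eigenspace *)
definition eig_proj :: "nat \<Rightarrow> complex mat \<Rightarrow> complex \<Rightarrow> complex mat" where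
  "eig_proj n H \<theta> = (THE P. P \<in> carrier_mat n n \<and> P * P = P \<and> ctrans P = P \<and>
       (*\<^sub>v) P ` carrier_vec n = eigenspace n H \<theta>)"

(* main angle beta = (1/sqrt n) sqrt((E j)^* (E j)) *)
definition main_angle :: "nat \<Rightarrow> complex mat \<Rightarrow> real \<Rightarrow> real" where
  "main_angle n H \<theta> =
     (let v = eig_proj n H (complex_of_real \<theta>) *\<^sub>v ones_vec n
      in (1 / sqrt (real n)) * sqrt (Re (\<Sum>i<n. cnj (v $ i) * v $ i)))"

(* the set of (real) main eigenvalues of the Hermitian matrix H *)
definition main_eigenvalues :: "nat \<Rightarrow> complex mat \<Rightarrow> real set" where
  "main_eigenvalues n H = {\<theta>. eigenvalue H (complex_of_real \<theta>) \<and> main_angle n H \<theta> \<noteq> 0}"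

end

theory Submission
  imports Defs "HOL-Computational_Algebra.Fundamental_Theorem_Algebra"
begin

text \<open>
  Let \<open>E\<^sub>\<theta>\<close> be the spectral projections of \<open>H\<close> and \<open>j = \<Sum>\<^sub>\<theta> E\<^sub>\<theta> j\<close>, where only main eigenvalues
  contribute. If \<open>M w = \<mu> w\<close>, pairing with \<open>E\<^sub>\<theta> j\<close> gives
  \<open>(\<mu> - \<theta>) \<langle>w, E\<^sub>\<theta> j\<rangle> = a \<langle>w, j\<rangle> n \<beta>\<^sub>\<theta>\<^sup>2\<close>, and summing over \<open>\<theta>\<close> shows that a main eigenvalue \<open>\<mu>\<close> of \<open>M\<close>
  is a root of the secular function \<open>f(x) = 1 + a \<Sum>\<^sub>\<theta> n \<beta>\<^sub>\<theta>\<^sup>2 / (\<theta> - x)\<close> other than a \<open>\<tau>\<^sub>i\<close>.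
  Conversely, for such a root \<open>\<mu>\<close> the vector \<open>\<Sum>\<^sub>\<theta> E\<^sub>\<theta> j / (\<theta> - \<mu>)\<close> is an eigenvector of \<open>M\<close> with
  non-zero main angle. Clearing denominators, \<open>\<Prod>\<^sub>i (x - \<tau>\<^sub>i) f(x)\<close> is a monic polynomial of degree
  \<open>r\<close> whose values at the \<open>\<tau>\<^sub>i\<close> alternate in sign, so it has one root in each gap between
  consecutive \<open>\<tau>\<^sub>i\<close> and one beyond \<open>\<tau>\<^sub>r\<close> (if \<open>a > 0\<close>) or below \<open>\<tau>\<^sub>1\<close> (if \<open>a < 0\<close>).

  The spectral projections are realised as Lagrange polynomials in \<open>H\<close>: the product of \<open>X - \<theta>\<close> over
  the eigenvalues annihilates the Hermitian matrix \<open>H\<close>.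
\<close>

section \<open>The standard inner product on \<open>\<complex>\<^sup>n\<close>\<close>

definition cinner :: "nat \<Rightarrow> complex vec \<Rightarrow> complex vec \<Rightarrow> complex" where
  "cinner n u v = (\<Sum>i<n. u $ i * cnj (v $ i))"

lemma smult_zero_vec [simp]: "(c :: 'a :: mult_zero) \<cdot>\<^sub>v 0\<^sub>v n = 0\<^sub>v n"
  by (rule eq_vecI) auto

lemma mult_mat_vec_index_sum:
  "A \<in> carrier_mat n m \<Longrightarrow> v \<in> carrier_vec m \<Longrightarrow> i < n \<Longrightarrow>
   (A *\<^sub>v v) $ i = (\<Sum>j<m. A $$ (i,j) * v $ j)"
  by (auto simp: scalar_prod_def atLeast0LessThan intro!: sum.cong)

lemma cinner_add_left:
  "u \<in> carrier_vec n \<Longrightarrow> w \<in> carrier_vec n \<Longrightarrow> cinner n (u + w) v = cinner n u v + cinner n w v"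
  by (auto simp: cinner_def distrib_right sum.distrib)

lemma cinner_add_right:
  "u \<in> carrier_vec n \<Longrightarrow> w \<in> carrier_vec n \<Longrightarrow> cinner n v (u + w) = cinner n v u + cinner n v w"
  by (auto simp: cinner_def distrib_left sum.distrib)

lemma cinner_smult_left: "u \<in> carrier_vec n \<Longrightarrow> cinner n (c \<cdot>\<^sub>v u) v = c * cinner n u v"
  by (auto simp: cinner_def sum_distrib_left mult.assoc)

lemma cinner_smult_right: "u \<in> carrier_vec n \<Longrightarrow> cinner n v (c \<cdot>\<^sub>v u) = cnj c * cinner n v u"
  by (auto simp: cinner_def sum_distrib_left intro!: sum.cong)

lemma cinner_zero_left [simp]: "cinner n (0\<^sub>v n) v = 0"
  by (simp add: cinner_def)

lemma cinner_zero_right [simp]: "cinner n v (0\<^sub>v n) = 0"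
  by (simp add: cinner_def)

lemma cnj_cinner: "cnj (cinner n u v) = cinner n v u"
  by (simp add: cinner_def mult.commute)

lemma cinner_unit_vec: "i < n \<Longrightarrow> cinner n u (unit_vec n i) = u $ i"
  by (simp add: cinner_def if_distrib cong: if_cong)

lemma cinner_self: "cinner n v v = of_real (\<Sum>i<n. (cmod (v $ i))\<^sup>2)"
  unfolding cinner_def of_real_sum by (intro sum.cong refl) (metis complex_norm_square)

lemma cinner_self_eq_0_iff:
  assumes "v \<in> carrier_vec n"
  shows "cinner n v v = 0 \<longleftrightarrow> v = 0\<^sub>v n"
proof
  assume "cinner n v v = 0"
  then have "(\<Sum>i<n. (cmod (v $ i))\<^sup>2) = 0"
    by (simp only: cinner_self of_real_eq_0_iff)
  then have "\<forall>i<n. v $ i = 0"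
    by (subst (asm) sum_nonneg_eq_0_iff) auto
  then show "v = 0\<^sub>v n"
    using assms by (auto intro!: eq_vecI)
qed simp

lemma cinner_ctrans:
  assumes A: "A \<in> carrier_mat n n" and u: "u \<in> carrier_vec n" and v: "v \<in> carrier_vec n"
  shows "cinner n (A *\<^sub>v u) v = cinner n u (ctrans A *\<^sub>v v)"
proof -
  have "cinner n (A *\<^sub>v u) v = (\<Sum>i<n. \<Sum>j<n. A $$ (i,j) * u $ j * cnj (v $ i))"
    unfolding cinner_def
    by (simp add: mult_mat_vec_index_sum[OF A u] sum_distrib_right del: index_mult_mat_vec)
  also have "\<dots> = (\<Sum>j<n. \<Sum>i<n. A $$ (i,j) * u $ j * cnj (v $ i))"
    by (rule sum.swap)
  also have "\<dots> = cinner n u (ctrans A *\<^sub>v v)"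
  proof -
    have "ctrans A \<in> carrier_mat n n"
      using A by (auto simp: ctrans_def)
    then have "(ctrans A *\<^sub>v v) $ j = (\<Sum>i<n. cnj (A $$ (i,j)) * v $ i)" if "j < n" for j
      using mult_mat_vec_index_sum[OF _ v that] A that by (simp add: ctrans_def del: index_mult_mat_vec)
    then show ?thesis
      unfolding cinner_def by (intro sum.cong refl) (simp add: sum_distrib_left mult_ac)
  qed
  finally show ?thesis .
qed

lemma cinner_hermitian:
  "hermitian_mat n A \<Longrightarrow> u \<in> carrier_vec n \<Longrightarrow> v \<in> carrier_vec n \<Longrightarrow>
   cinner n (A *\<^sub>v u) v = cinner n u (A *\<^sub>v v)"
  using cinner_ctrans[of A n u v] by (auto simp: hermitian_mat_def)

lemma ctrans_mult:
  "A \<in> carrier_mat n k \<Longrightarrow> B \<in> carrier_mat k m \<Longrightarrow> ctrans (A * B) = ctrans B * ctrans A"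
  by (auto intro!: eq_matI sum.cong simp: ctrans_def scalar_prod_def sum_conjugate[simplified] mult.commute)

lemma eq_mat_by_mult_vec:
  fixes A B :: "complex mat"
  assumes A: "A \<in> carrier_mat n n" and B: "B \<in> carrier_mat n n"
    and eq: "\<And>y. y \<in> carrier_vec n \<Longrightarrow> A *\<^sub>v y = B *\<^sub>v y"
  shows "A = B"
proof (rule eq_matI)
  fix i j assume ij: "i < dim_row B" "j < dim_col B"
  have "(A *\<^sub>v unit_vec n j) $ i = (B *\<^sub>v unit_vec n j) $ i"
    using eq[of "unit_vec n j"] by simp
  then show "A $$ (i,j) = B $$ (i,j)"
    using ij A B by (simp add: mult_mat_vec_index_sum if_distrib cong: if_cong)
qed (use A B in auto)

text \<open>A Hermitian idempotent is determined by its range, so \<open>eig_proj\<close> is well defined.\<close>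

lemma hermitian_idempotent_unique:
  fixes P Q :: "complex mat"
  assumes P: "P \<in> carrier_mat n n" "P * P = P" "ctrans P = P"
    and Q: "Q \<in> carrier_mat n n" "Q * Q = Q" "ctrans Q = Q"
    and range: "(*\<^sub>v) P ` carrier_vec n = (*\<^sub>v) Q ` carrier_vec n"
  shows "P = Q"
proof -
  have fixes_range: "X *\<^sub>v (Y *\<^sub>v y) = Y *\<^sub>v y"
    if X: "X \<in> carrier_mat n n" "X * X = X"
      and range_eq: "(*\<^sub>v) Y ` carrier_vec n = (*\<^sub>v) X ` carrier_vec n"
      and y: "y \<in> carrier_vec n" for X Y y
  proof -
    obtain x where x: "x \<in> carrier_vec n" "Y *\<^sub>v y = X *\<^sub>v x"
      using range_eq y by blast
    show ?thesis
      using assoc_mult_mat_vec[OF X(1) X(1) x(1)] x X by simp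
  qed
  have QP: "Q * P = P"
    by (rule eq_mat_by_mult_vec[of _ n])
      (use P Q range fixes_range[of Q P] in \<open>auto simp: assoc_mult_mat_vec\<close>)
  have PQ: "P * Q = Q"
    by (rule eq_mat_by_mult_vec[of _ n])
      (use P Q range fixes_range[of P Q] in \<open>auto simp: assoc_mult_mat_vec\<close>)
  have "ctrans (Q * P) = ctrans P * ctrans Q"
    using P Q by (simp add: ctrans_mult)
  then show ?thesis
    using P Q QP PQ by simp
qed

section \<open>Polynomials in a Hermitian matrix\<close>

definition real_poly :: "complex poly \<Rightarrow> bool" where
  "real_poly p \<longleftrightarrow> (\<forall>k. coeff p k \<in> \<real>)"

lemma real_poly_pCons: "real_poly (pCons a p) \<longleftrightarrow> a \<in> \<real> \<and> real_poly p"
  by (auto simp: real_poly_def coeff_pCons split: nat.splits)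

lemma real_poly_linear: "real_poly [:of_real t, 1:]"
  by (auto simp: real_poly_def coeff_pCons split: nat.splits)

lemma real_poly_smult: "c \<in> \<real> \<Longrightarrow> real_poly p \<Longrightarrow> real_poly (Polynomial.smult c p)"
  by (simp add: real_poly_def)

lemma real_poly_prod: "(\<And>x. x \<in> F \<Longrightarrow> real_poly (f x)) \<Longrightarrow> real_poly (\<Prod>x\<in>F. f x)"
proof (induct F rule: infinite_finite_induct)
  case (insert x F)
  then show ?case
    by (auto simp: real_poly_def coeff_mult intro!: sum_in_Reals)
qed (auto simp: real_poly_def coeff_1)

locale hermitian =
  fixes n :: nat and A :: "complex mat"
  assumes hermitian: "hermitian_mat n A"
begin

lemma carrier [simp]: "A \<in> carrier_mat n n"
  using hermitian by (simp add: hermitian_mat_def)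

lemma dim [simp]: "dim_row A = n" "dim_col A = n"
  using carrier_matD[OF carrier] by auto

lemma mult_vec_carrier [simp]: "v \<in> carrier_vec n \<Longrightarrow> A *\<^sub>v v \<in> carrier_vec n"
  by (rule mult_mat_vec_carrier[OF carrier])

definition power_vec :: "nat \<Rightarrow> complex vec \<Rightarrow> complex vec" where
  "power_vec k y = ((*\<^sub>v) A ^^ k) y"

definition poly_vec :: "complex poly \<Rightarrow> complex vec \<Rightarrow> complex vec" where
  "poly_vec p y = vec n (\<lambda>i. \<Sum>k\<le>degree p. coeff p k * power_vec k y $ i)"

lemma power_vec_0 [simp]: "power_vec 0 y = y"
  by (simp add: power_vec_def)

lemma power_vec_Suc: "power_vec (Suc k) y = A *\<^sub>v power_vec k y"
  by (simp add: power_vec_def)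

lemma power_vec_carrier [simp]: "y \<in> carrier_vec n \<Longrightarrow> power_vec k y \<in> carrier_vec n"
  by (induct k) (auto simp: power_vec_Suc)

lemma power_vec_Suc_index:
  "y \<in> carrier_vec n \<Longrightarrow> i < n \<Longrightarrow> power_vec (Suc k) y $ i = (\<Sum>j<n. A $$ (i,j) * power_vec k y $ j)"
  by (simp add: power_vec_Suc mult_mat_vec_index_sum[OF carrier, of "power_vec k y"] del: index_mult_mat_vec)

lemma power_vec_linear:
  assumes y: "y \<in> carrier_vec n" and i: "i < n"
  shows "power_vec k y $ i = (\<Sum>j<n. power_vec k (unit_vec n j) $ i * y $ j)"
  using i
proof (induct k arbitrary: i)
  case 0
  then have "(\<Sum>j<n. unit_vec n j $ i * y $ j) = (\<Sum>j<n. if j = i then y $ j else 0)"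
    by (intro sum.cong refl) auto
  then show ?case
    using 0 by simp
next
  case (Suc k i)
  have "power_vec (Suc k) y $ i = (\<Sum>l<n. A $$ (i,l) * power_vec k y $ l)"
    by (rule power_vec_Suc_index[OF y Suc(2)])
  also have "\<dots> = (\<Sum>l<n. \<Sum>j<n. A $$ (i,l) * (power_vec k (unit_vec n j) $ l * y $ j))"
    by (intro sum.cong refl) (simp add: Suc(1) sum_distrib_left)
  also have "\<dots> = (\<Sum>j<n. \<Sum>l<n. A $$ (i,l) * (power_vec k (unit_vec n j) $ l * y $ j))"
    by (rule sum.swap)
  also have "\<dots> = (\<Sum>j<n. power_vec (Suc k) (unit_vec n j) $ i * y $ j)"
    by (intro sum.cong refl)
      (simp add: power_vec_Suc_index[OF _ Suc(2)] sum_distrib_right sum_distrib_left mult_ac)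
  finally show ?case .
qed

lemma poly_vec_carrier [simp]: "poly_vec p y \<in> carrier_vec n"
  by (simp add: poly_vec_def)

lemma dim_poly_vec [simp]: "dim_vec (poly_vec p y) = n"
  by (simp add: poly_vec_def)

lemma poly_vec_index:
  assumes "degree p < D" "i < n"
  shows "poly_vec p y $ i = (\<Sum>k<D. coeff p k * power_vec k y $ i)"
proof -
  have "poly_vec p y $ i = (\<Sum>k\<le>degree p. coeff p k * power_vec k y $ i)"
    using assms by (simp add: poly_vec_def)
  also have "\<dots> = (\<Sum>k<D. coeff p k * power_vec k y $ i)"
    by (rule sum.mono_neutral_left) (use assms in \<open>auto simp: coeff_eq_0\<close>)
  finally show ?thesis .
qed

lemma poly_vec_0 [simp]: "poly_vec 0 y = 0\<^sub>v n"
  by (auto simp: poly_vec_def)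

lemma poly_vec_const [simp]: "y \<in> carrier_vec n \<Longrightarrow> poly_vec [:c:] y = c \<cdot>\<^sub>v y"
  by (auto simp: poly_vec_def intro!: eq_vecI)

lemma poly_vec_1: "y \<in> carrier_vec n \<Longrightarrow> poly_vec 1 y = y"
  by (metis poly_vec_const one_pCons smult_carrier_vec one_smult_vec)

lemma poly_vec_add: "poly_vec (p + q) y = poly_vec p y + poly_vec q y"
proof (rule eq_vecI)
  fix i assume "i < dim_vec (poly_vec p y + poly_vec q y)"
  then have i: "i < n" by simp
  define D where "D = Suc (max (degree p) (degree q))"
  have D: "degree p < D" "degree q < D" "degree (p + q) < D"
    unfolding D_def using degree_add_le_max[of p q] by auto
  show "poly_vec (p + q) y $ i = (poly_vec p y + poly_vec q y) $ i"
    using i by (simp add: poly_vec_index[OF D(1) i] poly_vec_index[OF D(2) i]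
        poly_vec_index[OF D(3) i] distrib_right sum.distrib)
qed simp

lemma poly_vec_sum:
  "finite F \<Longrightarrow> i < n \<Longrightarrow> poly_vec (\<Sum>x\<in>F. f x) y $ i = (\<Sum>x\<in>F. poly_vec (f x) y $ i)"
  by (induct F rule: finite_induct) (auto simp: poly_vec_add)

lemma poly_vec_smult: "poly_vec (Polynomial.smult c p) y = c \<cdot>\<^sub>v poly_vec p y"
proof (rule eq_vecI)
  fix i assume "i < dim_vec (c \<cdot>\<^sub>v poly_vec p y)"
  then have i: "i < n" by simp
  have D: "degree p < Suc (degree p)" "degree (Polynomial.smult c p) < Suc (degree p)"
    by auto
  show "poly_vec (Polynomial.smult c p) y $ i = (c \<cdot>\<^sub>v poly_vec p y) $ i"
    using i by (simp add: poly_vec_index[OF D(1) i] poly_vec_index[OF D(2) i]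
        sum_distrib_left mult.assoc ring_distribs)
qed simp

lemma poly_vec_monom_shift:
  assumes y: "y \<in> carrier_vec n"
  shows "poly_vec (pCons 0 p) y = A *\<^sub>v poly_vec p y"
proof (rule eq_vecI)
  fix i assume "i < dim_vec (A *\<^sub>v poly_vec p y)"
  then have i: "i < n" by simp
  define D where "D = Suc (degree p)"
  have D: "degree p < D" "degree (pCons 0 p) < Suc D"
    unfolding D_def by (auto simp: degree_pCons_le)
  have "poly_vec (pCons 0 p) y $ i = (\<Sum>k<D. coeff p k * power_vec (Suc k) y $ i)"
    by (simp add: poly_vec_index[OF D(2) i] sum.lessThan_Suc_shift del: sum.lessThan_Suc)
  also have "\<dots> = (\<Sum>j<n. \<Sum>k<D. coeff p k * (A $$ (i,j) * power_vec k y $ j))"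
    using y i by (simp add: power_vec_Suc_index sum_distrib_left sum.swap[of _ "{..<D}"])
  also have "\<dots> = (\<Sum>j<n. A $$ (i,j) * poly_vec p y $ j)"
    by (intro sum.cong refl) (simp add: poly_vec_index[OF D(1)] sum_distrib_left mult_ac)
  also have "\<dots> = (A *\<^sub>v poly_vec p y) $ i"
    using i by (simp add: mult_mat_vec_index_sum[OF carrier poly_vec_carrier i] del: index_mult_mat_vec)
  finally show "poly_vec (pCons 0 p) y $ i = (A *\<^sub>v poly_vec p y) $ i" .
qed simp

lemma poly_vec_pCons:
  assumes y: "y \<in> carrier_vec n"
  shows "poly_vec (pCons c p) y = c \<cdot>\<^sub>v y + A *\<^sub>v poly_vec p y"
proof -
  have "pCons c p = [:c:] + pCons 0 p" by simp
  then have "poly_vec (pCons c p) y = poly_vec [:c:] y + poly_vec (pCons 0 p) y"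
    by (metis poly_vec_add)
  then show ?thesis
    using y by (simp add: poly_vec_const poly_vec_monom_shift)
qed

lemma poly_vec_mult:
  assumes y: "y \<in> carrier_vec n"
  shows "poly_vec (p * q) y = poly_vec p (poly_vec q y)"
proof (induct p)
  case (pCons c p)
  have "poly_vec (pCons c p * q) y = c \<cdot>\<^sub>v poly_vec q y + A *\<^sub>v poly_vec (p * q) y"
    using y by (simp add: poly_vec_add poly_vec_smult poly_vec_monom_shift)
  then show ?case
    using pCons by (simp add: poly_vec_pCons)
qed simp

lemma poly_vec_commute:
  "y \<in> carrier_vec n \<Longrightarrow> poly_vec p (poly_vec q y) = poly_vec q (poly_vec p y)"
  by (metis poly_vec_mult mult.commute)

lemma poly_vec_linear_eq_0_iff:
  assumes v: "v \<in> carrier_vec n"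
  shows "poly_vec [:-z, 1:] v = 0\<^sub>v n \<longleftrightarrow> A *\<^sub>v v = z \<cdot>\<^sub>v v"
proof -
  have "poly_vec [:-z, 1:] v = (- z) \<cdot>\<^sub>v v + A *\<^sub>v v"
    using v poly_vec_pCons[OF v, of "-z" "[:1:]"] by simp
  moreover have "(- z) \<cdot>\<^sub>v v + A *\<^sub>v v = 0\<^sub>v n \<longleftrightarrow> A *\<^sub>v v = z \<cdot>\<^sub>v v"
  proof
    assume eq: "(- z) \<cdot>\<^sub>v v + A *\<^sub>v v = 0\<^sub>v n"
    show "A *\<^sub>v v = z \<cdot>\<^sub>v v"
    proof (rule eq_vecI)
      fix i assume "i < dim_vec (z \<cdot>\<^sub>v v)"
      then have i: "i < n" using v by simp
      then have "((- z) \<cdot>\<^sub>v v + A *\<^sub>v v) $ i = 0" using eq by simp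
      then show "(A *\<^sub>v v) $ i = (z \<cdot>\<^sub>v v) $ i"
        using i v by (simp add: algebra_simps)
    qed (use v in simp)
  qed (use v in \<open>auto intro!: eq_vecI\<close>)
  ultimately show ?thesis by simp
qed

lemma poly_vec_eigenvector:
  assumes v: "v \<in> carrier_vec n" and eig: "A *\<^sub>v v = z \<cdot>\<^sub>v v"
  shows "poly_vec p v = poly p z \<cdot>\<^sub>v v"
proof (induct p)
  case (pCons c p)
  have "A *\<^sub>v (poly p z \<cdot>\<^sub>v v) = poly p z \<cdot>\<^sub>v (z \<cdot>\<^sub>v v)"
    using v eig by (simp add: mult_mat_vec[OF carrier v])
  then show ?case
    using v pCons by (auto intro!: eq_vecI simp: poly_vec_pCons algebra_simps)
qed (use v in \<open>auto intro!: eq_vecI\<close>)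

lemma cinner_self_adjoint: "u \<in> carrier_vec n \<Longrightarrow> v \<in> carrier_vec n \<Longrightarrow>
  cinner n (A *\<^sub>v u) v = cinner n u (A *\<^sub>v v)"
  by (rule cinner_hermitian[OF hermitian])

lemma cinner_poly_vec:
  assumes "real_poly p" and "u \<in> carrier_vec n" and "v \<in> carrier_vec n"
  shows "cinner n (poly_vec p u) v = cinner n u (poly_vec p v)"
  using assms
proof (induct p arbitrary: v)
  case (pCons c p v)
  have c: "cnj c = c" and p: "real_poly p" and u: "u \<in> carrier_vec n" and v: "v \<in> carrier_vec n"
    using pCons.prems by (auto simp: real_poly_pCons Reals_cnj_iff)
  have "poly_vec p (A *\<^sub>v v) = A *\<^sub>v poly_vec p v"
    using poly_vec_commute[OF v, of p "[:0,1:]"] v by (simp add: poly_vec_monom_shift poly_vec_1)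
  then have "cinner n (poly_vec p u) (A *\<^sub>v v) = cinner n u (A *\<^sub>v poly_vec p v)"
    using pCons.hyps(2)[OF p u, of "A *\<^sub>v v"] v by simp
  then show ?case
    using u v c by (simp add: poly_vec_pCons cinner_add_left cinner_add_right cinner_smult_left
        cinner_smult_right cinner_self_adjoint)
qed simp

end

section \<open>Spectral projections\<close>

context hermitian
begin

lemma eigenvalue_real:
  assumes "eigenvalue A z"
  shows "z \<in> \<real>"
proof -
  obtain v where v: "v \<in> carrier_vec n" "v \<noteq> 0\<^sub>v n" "A *\<^sub>v v = z \<cdot>\<^sub>v v"
    using assms unfolding eigenvalue_def eigenvector_def by auto
  have "z * cinner n v v = cnj z * cinner n v v"
    using cinner_self_adjoint[OF v(1) v(1)] v by (simp add: cinner_smult_left cinner_smult_right)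
  moreover have "cinner n v v \<noteq> 0"
    using cinner_self_eq_0_iff[OF v(1)] v(2) by simp
  ultimately show ?thesis
    by (simp add: Reals_cnj_iff)
qed

definition eigvals :: "real set" where
  "eigvals = {\<theta>. eigenvalue A (of_real \<theta>)}"

lemma finite_eigvals: "finite eigvals"
proof -
  have "char_poly A \<noteq> 0"
    using degree_monic_char_poly[OF carrier] by auto
  then have "finite (of_real -` {z. poly (char_poly A) z = 0} :: real set)"
    by (intro finite_vimageI poly_roots_finite) (auto simp: inj_on_def)
  moreover have "eigvals \<subseteq> of_real -` {z. poly (char_poly A) z = 0}"
    unfolding eigvals_def using eigenvalue_root_char_poly[OF carrier] by auto
  ultimately show ?thesis
    by (rule finite_subset[rotated])
qed

definition eig_poly :: "complex poly" where
  "eig_poly = (\<Prod>\<theta>\<in>eigvals. [:- of_real \<theta>, 1:])"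

lemma real_poly_eig_poly: "real_poly eig_poly"
  unfolding eig_poly_def using real_poly_linear[of "- _"] by (intro real_poly_prod) simp

lemma poly_eig_poly: "\<theta> \<in> eigvals \<Longrightarrow> poly eig_poly (of_real \<theta>) = 0"
  unfolding eig_poly_def poly_prod using finite_eigvals by (auto intro: prod_zero)

lemma exists_annihilating_poly:
  assumes u: "u \<in> carrier_vec n"
  shows "\<exists>p. p \<noteq> 0 \<and> poly_vec p u = 0\<^sub>v n"
proof -
  define c where "c i = vec (Suc n) (\<lambda>k. power_vec k u $ i)" for i
  define C where "C = mat\<^sub>r (Suc n) (Suc n) (\<lambda>i. if i = n then 0\<^sub>v (Suc n) else c i)"
  have C: "C \<in> carrier_mat (Suc n) (Suc n)"
    unfolding C_def by auto
  have "det C = 0"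
    unfolding C_def by (rule det_row_0) (auto simp: c_def)
  then obtain x where x: "x \<in> carrier_vec (Suc n)" "x \<noteq> 0\<^sub>v (Suc n)" "C *\<^sub>v x = 0\<^sub>v (Suc n)"
    using det_0_iff_vec_prod_zero[OF C] by auto
  define p where "p = (\<Sum>k<Suc n. monom (x $ k) k)"
  have coeff_p: "coeff p j = (if j < Suc n then x $ j else 0)" for j
    unfolding p_def coeff_sum coeff_monom by (auto simp: sum.delta)
  have "p \<noteq> 0"
  proof
    assume "p = 0"
    then have "\<forall>j<Suc n. x $ j = 0"
      using coeff_p by (metis coeff_0)
    then show False
      using x by (auto intro!: eq_vecI)
  qed
  moreover have "poly_vec p u = 0\<^sub>v n"
  proof (rule eq_vecI)
    fix i assume "i < dim_vec (0\<^sub>v n :: complex vec)"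
    then have i: "i < n" by simp
    have deg: "degree p < Suc n"
      using coeff_p by (intro le_imp_less_Suc degree_le) auto
    have "(C *\<^sub>v x) $ i = 0"
      using x(3) i by simp
    then have "(\<Sum>k<Suc n. C $$ (i,k) * x $ k) = 0"
      using mult_mat_vec_index_sum[OF C x(1), of i] i by simp
    then have "(\<Sum>k<Suc n. power_vec k u $ i * x $ k) = 0"
      using i by (simp add: C_def c_def)
    then show "poly_vec p u $ i = 0\<^sub>v n $ i"
      using i by (simp add: poly_vec_index[OF deg i] coeff_p mult.commute)
  qed simp
  ultimately show ?thesis by blast
qed

text \<open>\<open>v\<close> lies in the kernel and in the range of the self-adjoint \<open>eig_poly(A)\<close>, hence \<open>v \<bottom> v\<close>.\<close>

lemma eigenvector_in_range_eig_poly: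
  assumes u: "u \<in> carrier_vec n" and eig: "A *\<^sub>v v = z \<cdot>\<^sub>v v" and v: "v = poly_vec eig_poly u"
  shows "v = 0\<^sub>v n"
proof (rule ccontr)
  assume "v \<noteq> 0\<^sub>v n"
  then have "eigenvalue A z"
    using v eig poly_vec_carrier[of eig_poly u] unfolding eigenvalue_def eigenvector_def dim by blast
  moreover obtain t where t: "z = of_real t"
    using eigenvalue_real[OF \<open>eigenvalue A z\<close>] by (auto elim: Reals_cases)
  ultimately have "t \<in> eigvals"
    by (simp add: eigvals_def)
  then have "poly_vec eig_poly v = 0\<^sub>v n"
    using poly_vec_eigenvector[OF _ eig] poly_eig_poly t v by (auto intro!: eq_vecI)
  then have "cinner n v v = 0"
    using cinner_poly_vec[OF real_poly_eig_poly u, of v] v by simp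
  with \<open>v \<noteq> 0\<^sub>v n\<close> show False
    using cinner_self_eq_0_iff v by simp
qed

lemma eig_poly_annihilated:
  "p \<noteq> 0 \<Longrightarrow> w \<in> carrier_vec n \<Longrightarrow> poly_vec p (poly_vec eig_poly w) = 0\<^sub>v n \<Longrightarrow>
   poly_vec eig_poly w = 0\<^sub>v n"
proof (induct "degree p" arbitrary: p w rule: less_induct)
  case less
  note p0 = less.prems(1) and w = less.prems(2) and kill = less.prems(3)
  show ?case
  proof (cases "degree p = 0")
    case True
    then have p: "p = [:coeff p 0:]" and "coeff p 0 \<noteq> 0"
      using p0 by (metis degree_0_id, metis degree_0_id pCons_0_0)
    then have "coeff p 0 \<cdot>\<^sub>v poly_vec eig_poly w = 0\<^sub>v n"
      using kill by (metis poly_vec_const poly_vec_carrier)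
    moreover have "poly_vec eig_poly w = inverse (coeff p 0) \<cdot>\<^sub>v (coeff p 0 \<cdot>\<^sub>v poly_vec eig_poly w)"
      using \<open>coeff p 0 \<noteq> 0\<close> by (simp add: smult_smult_assoc)
    ultimately show ?thesis
      by simp
  next
    case False
    then obtain z where "poly p z = 0"
      using fundamental_theorem_of_algebra[of p] constant_degree[of p] by auto
    then obtain q where pq: "p = [:-z, 1:] * q"
      by (auto simp: poly_eq_0_iff_dvd dvd_def)
    with p0 have q0: "q \<noteq> 0" by auto
    then have deg: "degree q < degree p"
      using pq degree_mult_eq[of "[:-z, 1:]" q] by simp
    have v: "poly_vec q (poly_vec eig_poly w) = poly_vec eig_poly (poly_vec q w)"
      using w by (simp add: poly_vec_commute)
    have "poly_vec [:-z, 1:] (poly_vec q (poly_vec eig_poly w)) = 0\<^sub>v n"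
      using kill unfolding pq by (simp only: poly_vec_mult[OF poly_vec_carrier])
    then have "A *\<^sub>v poly_vec q (poly_vec eig_poly w) = z \<cdot>\<^sub>v poly_vec q (poly_vec eig_poly w)"
      using poly_vec_linear_eq_0_iff[OF poly_vec_carrier] by simp
    then have "poly_vec q (poly_vec eig_poly w) = 0\<^sub>v n"
      using eigenvector_in_range_eig_poly[OF poly_vec_carrier _ v] by simp
    then show ?thesis
      using less.hyps[OF deg q0 w] by simp
  qed
qed

lemma poly_vec_eig_poly: "w \<in> carrier_vec n \<Longrightarrow> poly_vec eig_poly w = 0\<^sub>v n"
  using exists_annihilating_poly[OF poly_vec_carrier, of eig_poly w] eig_poly_annihilated by blast

lemma eigvals_nonempty:
  assumes "n > 0"
  shows "eigvals \<noteq> {}"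
proof
  assume "eigvals = {}"
  then have "unit_vec n 0 = (0\<^sub>v n :: complex vec)"
    using poly_vec_eig_poly[of "unit_vec n 0"] by (simp add: eig_poly_def poly_vec_1)
  then show False
    using assms by (metis index_unit_vec(1) index_zero_vec(1) zero_neq_one)
qed

definition poly_mat :: "complex poly \<Rightarrow> complex mat" where
  "poly_mat p = mat n n (\<lambda>(i,j). poly_vec p (unit_vec n j) $ i)"

lemma poly_mat_carrier [simp]: "poly_mat p \<in> carrier_mat n n"
  by (simp add: poly_mat_def)

lemma poly_mat_mult_vec:
  assumes y: "y \<in> carrier_vec n"
  shows "poly_mat p *\<^sub>v y = poly_vec p y"
proof (rule eq_vecI)
  fix i assume "i < dim_vec (poly_vec p y)"
  then have i: "i < n" by simp
  have deg: "degree p < Suc (degree p)" by simp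
  have "(poly_mat p *\<^sub>v y) $ i = (\<Sum>j<n. poly_vec p (unit_vec n j) $ i * y $ j)"
    by (subst mult_mat_vec_index_sum[OF poly_mat_carrier y i]) (auto simp: poly_mat_def i intro!: sum.cong)
  also have "\<dots> = (\<Sum>k<Suc (degree p). \<Sum>j<n. coeff p k * power_vec k (unit_vec n j) $ i * y $ j)"
    by (simp add: poly_vec_index[OF deg i] sum_distrib_right sum.swap[of _ "{..<n}"] del: sum.lessThan_Suc)
  also have "\<dots> = poly_vec p y $ i"
    by (simp add: poly_vec_index[OF deg i] power_vec_linear[OF y i] sum_distrib_left mult_ac)
  finally show "(poly_mat p *\<^sub>v y) $ i = poly_vec p y $ i" .
qed (simp add: poly_mat_def)

lemma ctrans_poly_mat:
  assumes "real_poly p"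
  shows "ctrans (poly_mat p) = poly_mat p"
proof (rule eq_matI)
  fix i j assume "i < dim_row (poly_mat p)" "j < dim_col (poly_mat p)"
  then have ij: "i < n" "j < n"
    by (simp_all add: poly_mat_def)
  have "ctrans (poly_mat p) $$ (i,j) = cnj (cinner n (poly_vec p (unit_vec n i)) (unit_vec n j))"
    using ij by (simp add: ctrans_def poly_mat_def cinner_unit_vec)
  also have "\<dots> = cinner n (poly_vec p (unit_vec n j)) (unit_vec n i)"
    using cinner_poly_vec[OF assms, of "unit_vec n j" "unit_vec n i"] by (simp add: cnj_cinner)
  also have "\<dots> = poly_mat p $$ (i,j)"
    using ij by (simp add: cinner_unit_vec poly_mat_def)
  finally show "ctrans (poly_mat p) $$ (i,j) = poly_mat p $$ (i,j)" .
qed (auto simp: ctrans_def poly_mat_def)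

definition lagrange :: "real \<Rightarrow> complex poly" where
  "lagrange \<theta> = Polynomial.smult (of_real (1 / (\<Prod>t\<in>eigvals - {\<theta>}. \<theta> - t)))
     (\<Prod>t\<in>eigvals - {\<theta>}. [:- of_real t, 1:])"

lemma real_poly_lagrange: "real_poly (lagrange \<theta>)"
  unfolding lagrange_def using real_poly_linear[of "- _"]
  by (intro real_poly_smult real_poly_prod) auto

lemma poly_lagrange:
  assumes "t \<in> eigvals"
  shows "poly (lagrange \<theta>) (of_real t) = (if t = \<theta> then 1 else 0)"
  using assms finite_eigvals by (simp add: lagrange_def poly_prod prod_zero_iff)

lemma linear_mult_lagrange:
  "\<theta> \<in> eigvals \<Longrightarrow>
   [:- of_real \<theta>, 1:] * lagrange \<theta> = Polynomial.smult (of_real (1 / (\<Prod>t\<in>eigvals - {\<theta>}. \<theta> - t))) eig_poly"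
  unfolding lagrange_def eig_poly_def prod.remove[OF finite_eigvals] by (simp only: mult_smult_right)

lemma degree_lagrange:
  assumes "\<theta> \<in> eigvals"
  shows "degree (lagrange \<theta>) < card eigvals"
proof -
  have "degree (\<Prod>t\<in>eigvals - {\<theta>}. [:- (of_real t :: complex), 1:]) \<le> card (eigvals - {\<theta>})"
    using degree_prod_sum_le[of "eigvals - {\<theta>}" "\<lambda>t. [:- (of_real t :: complex), 1:]"] finite_eigvals
    by (simp add: o_def)
  then have "degree (lagrange \<theta>) \<le> card (eigvals - {\<theta>})"
    unfolding lagrange_def by (meson degree_smult_le order_trans)
  then show ?thesis
    using card_Diff1_less[OF finite_eigvals assms] by linarith
qed

lemma sum_lagrange:
  assumes "eigvals \<noteq> {}"
  shows "(\<Sum>\<theta>\<in>eigvals. lagrange \<theta>) = 1"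
proof (rule poly_eqI_degree[of "of_real ` eigvals"])
  have card: "card (of_real ` eigvals :: complex set) = card eigvals"
    by (rule card_image) (auto simp: inj_on_def)
  show "poly (\<Sum>\<theta>\<in>eigvals. lagrange \<theta>) x = poly 1 x" if "x \<in> of_real ` eigvals" for x
    using that finite_eigvals by (auto simp: poly_sum poly_lagrange if_distrib cong: sum.cong)
  have "degree (\<Sum>\<theta>\<in>eigvals. lagrange \<theta>) < card eigvals"
    using degree_lagrange assms finite_eigvals by (intro degree_sum_less) (auto simp: card_gt_0_iff)
  then show "degree (\<Sum>\<theta>\<in>eigvals. lagrange \<theta>) < card (of_real ` eigvals :: complex set)"
    using card by simp
  show "degree (1 :: complex poly) < card (of_real ` eigvals :: complex set)"
    using card assms finite_eigvals by (simp add: card_gt_0_iff)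
qed

lemma lagrange_eigenvector:
  assumes \<theta>: "\<theta> \<in> eigvals" and y: "y \<in> carrier_vec n"
  shows "A *\<^sub>v poly_vec (lagrange \<theta>) y = of_real \<theta> \<cdot>\<^sub>v poly_vec (lagrange \<theta>) y"
proof -
  have "poly_vec [:- of_real \<theta>, 1:] (poly_vec (lagrange \<theta>) y) = poly_vec ([:- of_real \<theta>, 1:] * lagrange \<theta>) y"
    by (rule poly_vec_mult[OF y, symmetric])
  also have "\<dots> = 0\<^sub>v n"
    unfolding linear_mult_lagrange[OF \<theta>] poly_vec_smult using poly_vec_eig_poly[OF y] by simp
  finally show ?thesis
    using poly_vec_linear_eq_0_iff[OF poly_vec_carrier] by simp
qed

lemma eig_proj_eq_poly_mat:
  assumes \<theta>: "\<theta> \<in> eigvals"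
  shows "eig_proj n A (of_real \<theta>) = poly_mat (lagrange \<theta>)"
proof -
  let ?P = "poly_mat (lagrange \<theta>)"
  have into: "?P *\<^sub>v y \<in> eigenspace n A (of_real \<theta>)" if "y \<in> carrier_vec n" for y
    using lagrange_eigenvector[OF \<theta> that] that by (simp add: poly_mat_mult_vec eigenspace_def)
  have fixed: "?P *\<^sub>v v = v" if "v \<in> eigenspace n A (of_real \<theta>)" for v
    using that poly_vec_eigenvector[of v "of_real \<theta>" "lagrange \<theta>"] poly_lagrange[OF \<theta>, of \<theta>]
    by (simp add: eigenspace_def poly_mat_mult_vec)
  have range: "(*\<^sub>v) ?P ` carrier_vec n = eigenspace n A (of_real \<theta>)"
    using into fixed by (auto simp: eigenspace_def intro: image_eqI[of _ "(*\<^sub>v) ?P", OF sym])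
  have idem: "?P * ?P = ?P"
    by (rule eq_mat_by_mult_vec[of _ n])
      (use assoc_mult_mat_vec[OF poly_mat_carrier poly_mat_carrier] fixed into in
        \<open>auto intro: mult_carrier_mat[OF poly_mat_carrier poly_mat_carrier]\<close>)
  have "ctrans ?P = ?P"
    by (rule ctrans_poly_mat[OF real_poly_lagrange])
  then show ?thesis
    unfolding eig_proj_def
    using hermitian_idempotent_unique[of _ n ?P] idem range by (intro the_equality) auto
qed

lemma sum_eig_proj_mult_vec:
  assumes y: "y \<in> carrier_vec n" and i: "i < n"
  shows "(\<Sum>\<theta>\<in>eigvals. (eig_proj n A (of_real \<theta>) *\<^sub>v y) $ i) = y $ i"
proof -
  have "(\<Sum>\<theta>\<in>eigvals. (eig_proj n A (of_real \<theta>) *\<^sub>v y) $ i) = poly_vec (\<Sum>\<theta>\<in>eigvals. lagrange \<theta>) y $ i"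
    by (simp add: poly_vec_sum[OF finite_eigvals i] eig_proj_eq_poly_mat poly_mat_mult_vec[OF y])
  also have "\<dots> = y $ i"
    using sum_lagrange eigvals_nonempty i y by (simp add: poly_vec_1)
  finally show ?thesis .
qed

lemma eig_proj_mult_vec_carrier [simp]:
  "\<theta> \<in> eigvals \<Longrightarrow> y \<in> carrier_vec n \<Longrightarrow> eig_proj n A (of_real \<theta>) *\<^sub>v y \<in> carrier_vec n"
  by (simp add: eig_proj_eq_poly_mat poly_mat_mult_vec)

lemma cinner_eig_proj:
  "\<theta> \<in> eigvals \<Longrightarrow> u \<in> carrier_vec n \<Longrightarrow> v \<in> carrier_vec n \<Longrightarrow>
   cinner n (eig_proj n A (of_real \<theta>) *\<^sub>v u) v = cinner n u (eig_proj n A (of_real \<theta>) *\<^sub>v v)"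
  by (simp add: eig_proj_eq_poly_mat poly_mat_mult_vec cinner_poly_vec real_poly_lagrange)

lemma eig_proj_eigenvector:
  "\<theta> \<in> eigvals \<Longrightarrow> y \<in> carrier_vec n \<Longrightarrow>
   A *\<^sub>v (eig_proj n A (of_real \<theta>) *\<^sub>v y) = of_real \<theta> \<cdot>\<^sub>v (eig_proj n A (of_real \<theta>) *\<^sub>v y)"
  by (simp add: eig_proj_eq_poly_mat poly_mat_mult_vec lagrange_eigenvector)

lemma eig_proj_fixes_eigenvector:
  assumes "\<theta> \<in> eigvals" "v \<in> carrier_vec n" "A *\<^sub>v v = of_real \<theta> \<cdot>\<^sub>v v"
  shows "eig_proj n A (of_real \<theta>) *\<^sub>v v = v"
  using assms poly_vec_eigenvector[OF assms(2,3), of "lagrange \<theta>"] poly_lagrange[OF assms(1), of \<theta>]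
  by (simp add: eig_proj_eq_poly_mat poly_mat_mult_vec)

lemma eig_proj_idem:
  "\<theta> \<in> eigvals \<Longrightarrow> y \<in> carrier_vec n \<Longrightarrow>
   eig_proj n A (of_real \<theta>) *\<^sub>v (eig_proj n A (of_real \<theta>) *\<^sub>v y) = eig_proj n A (of_real \<theta>) *\<^sub>v y"
  by (rule eig_proj_fixes_eigenvector[OF _ _ eig_proj_eigenvector]) simp_all

end

section \<open>Roots of the secular equation\<close>

lemma sign_prod_diffs:
  fixes t :: "nat \<Rightarrow> real"
  assumes mono: "\<And>i j. i < j \<Longrightarrow> j < r \<Longrightarrow> t i < t j" and k: "k < r"
  shows "(-1) ^ (r - 1 - k) * (\<Prod>i\<in>{..<r} - {k}. t k - t i) > 0"
proof -
  have below: "(\<Prod>i<k. t k - t i) > 0"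
    by (rule prod_pos) (use mono k in auto)
  have above: "(\<Prod>i\<in>{Suc k..<r}. t i - t k) > 0"
    by (rule prod_pos) (use mono in auto)
  have flip: "(\<Prod>i\<in>{Suc k..<r}. t k - t i) = (-1) ^ (r - 1 - k) * (\<Prod>i\<in>{Suc k..<r}. t i - t k)"
    using prod_uminus[of "\<lambda>i. t i - t k" "{Suc k..<r}"] by simp
  have split: "{..<r} - {k} = {..<k} \<union> {Suc k..<r}"
    using k by auto
  have "(\<Prod>i\<in>{..<r} - {k}. t k - t i) = (\<Prod>i<k. t k - t i) * (\<Prod>i\<in>{Suc k..<r}. t k - t i)"
    unfolding split by (rule prod.union_disjoint) auto
  then have "(-1) ^ (r - 1 - k) * (\<Prod>i\<in>{..<r} - {k}. t k - t i) =
      ((-1) ^ (r - 1 - k)) ^ 2 * ((\<Prod>i<k. t k - t i) * (\<Prod>i\<in>{Suc k..<r}. t i - t k))"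
    by (simp add: flip power2_eq_square mult_ac)
  also have "\<dots> = (\<Prod>i<k. t k - t i) * (\<Prod>i\<in>{Suc k..<r}. t i - t k)"
    by (simp add: power_even_eq[symmetric] flip: power_mult)
  finally show ?thesis
    using below above by simp
qed

locale secular =
  fixes r :: nat and t w :: "nat \<Rightarrow> real" and a :: real
  assumes mono: "\<And>i j. i < j \<Longrightarrow> j < r \<Longrightarrow> t i < t j"
    and weight_pos: "\<And>k. k < r \<Longrightarrow> w k > 0"
    and nonzero: "a \<noteq> 0"
begin

definition secular_fun :: "real \<Rightarrow> real" where
  "secular_fun x = 1 + a * (\<Sum>k<r. w k / (t k - x))"

text \<open>The numerator of \<open>secular_fun\<close>, up to the sign \<open>(-1)\<^sup>r\<close>.\<close>

definition secular_poly :: "real poly" where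
  "secular_poly = (\<Prod>k<r. [:- t k, 1:]) -
     Polynomial.smult a (\<Sum>k<r. Polynomial.smult (w k) (\<Prod>i\<in>{..<r} - {k}. [:- t i, 1:]))"

lemma mono_le: "i \<le> j \<Longrightarrow> j < r \<Longrightarrow> t i \<le> t j"
  using mono by (cases "i = j") (auto simp: less_le)

lemma a_sq_pos: "a * a > 0"
  using nonzero by (cases "a > 0") (auto intro: mult_neg_neg)

lemma poly_secular_poly:
  "poly secular_poly x = (\<Prod>k<r. x - t k) - a * (\<Sum>k<r. w k * (\<Prod>i\<in>{..<r} - {k}. x - t i))"
  by (simp add: secular_poly_def poly_prod poly_sum)

lemma poly_secular_poly_eq:
  assumes x: "x \<notin> t ` {..<r}"
  shows "poly secular_poly x = (\<Prod>k<r. x - t k) * secular_fun x"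
proof -
  have nz: "x - t k \<noteq> 0" if "k < r" for k
    using x that by auto
  have "w k * (\<Prod>i\<in>{..<r} - {k}. x - t i) = (\<Prod>k<r. x - t k) * - (w k / (t k - x))"
    if k: "k < r" for k
  proof -
    have "(\<Prod>i\<in>{..<r} - {k}. x - t i) = (\<Prod>k<r. x - t k) / (x - t k)"
      using prod.remove[of "{..<r}" k "\<lambda>i. x - t i"] k nz[OF k] by simp
    then show ?thesis
      using nz[OF k] by (simp add: field_simps)
  qed
  then have "(\<Sum>k<r. w k * (\<Prod>i\<in>{..<r} - {k}. x - t i)) = - (\<Prod>k<r. x - t k) * (\<Sum>k<r. w k / (t k - x))"
    by (simp add: sum_distrib_left sum_negf)
  then show ?thesis
    unfolding poly_secular_poly secular_fun_def by (simp add: algebra_simps)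
qed

lemma poly_secular_poly_at:
  assumes k: "k < r"
  shows "poly secular_poly (t k) = - a * w k * (\<Prod>i\<in>{..<r} - {k}. t k - t i)"
proof -
  have "(\<Sum>j<r. w j * (\<Prod>i\<in>{..<r} - {j}. t k - t i)) =
      (\<Sum>j<r. if j = k then w k * (\<Prod>i\<in>{..<r} - {k}. t k - t i) else 0)"
    by (intro sum.cong refl) (use k in \<open>auto intro!: prod_zero\<close>)
  moreover have "(\<Prod>i<r. t k - t i) = 0"
    using k by (auto intro: prod_zero)
  ultimately show ?thesis
    using k by (simp add: poly_secular_poly)
qed

lemma sign_secular_poly_at:
  assumes k: "k < r"
  shows "a * ((-1) ^ (r - 1 - k) * poly secular_poly (t k)) < 0"
proof -
  have "a * ((-1) ^ (r - 1 - k) * poly secular_poly (t k)) =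
      - (a * a) * w k * ((-1) ^ (r - 1 - k) * (\<Prod>i\<in>{..<r} - {k}. t k - t i))"
    by (simp add: poly_secular_poly_at[OF k])
  moreover have "(-1) ^ (r - 1 - k) * (\<Prod>i\<in>{..<r} - {k}. t k - t i) > 0"
    by (rule sign_prod_diffs[OF mono k])
  ultimately show ?thesis
    using weight_pos[OF k] a_sq_pos by (simp add: mult_pos_pos)
qed

lemma sign_change_secular_poly:
  assumes k: "Suc k < r"
  shows "poly secular_poly (t k) * poly secular_poly (t (Suc k)) < 0"
proof -
  have e: "r - 1 - k = Suc (r - 1 - Suc k)"
    using k by simp
  have "0 < (a * ((-1) ^ (r - 1 - k) * poly secular_poly (t k))) *
      (a * ((-1) ^ (r - 1 - Suc k) * poly secular_poly (t (Suc k))))"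
    using sign_secular_poly_at[of k] sign_secular_poly_at[of "Suc k"] k by (simp add: mult_neg_neg)
  also have "\<dots> = - (a * a) * (((-1) ^ (r - 1 - Suc k)) ^ 2 *
      (poly secular_poly (t k) * poly secular_poly (t (Suc k))))"
    unfolding e by (simp add: power2_eq_square mult_ac)
  also have "\<dots> = - (a * a) * (poly secular_poly (t k) * poly secular_poly (t (Suc k)))"
    by (simp add: power_even_eq[symmetric] flip: power_mult)
  finally show ?thesis
    using a_sq_pos by (simp add: mult_less_0_iff)
qed

lemma secular_poly_nonzero_at: "k < r \<Longrightarrow> poly secular_poly (t k) \<noteq> 0"
  using sign_secular_poly_at[of k] by auto

definition total_weight :: real where
  "total_weight = (\<Sum>k<r. w k)"

lemma total_weight_nonneg: "total_weight \<ge> 0"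
  unfolding total_weight_def by (rule sum_nonneg) (use weight_pos in \<open>auto simp: less_imp_le\<close>)

text \<open>
  Beyond \<open>1 + \<bar>a\<bar> * total_weight\<close> from the poles the sum in \<open>secular_fun\<close> is too small to
  compensate the leading \<open>1\<close>.\<close>

lemma secular_poly_pos_right:
  assumes a: "a > 0" and r: "r > 0"
  shows "poly secular_poly (t (r - 1) + 1 + a * total_weight) > 0"
proof -
  define X where "X = t (r - 1) + 1 + a * total_weight"
  have aW: "a * total_weight \<ge> 0"
    using a total_weight_nonneg by simp
  have dist: "X - t k \<ge> 1 + a * total_weight" if "k < r" for k
    using mono_le[of k "r - 1"] that r by (simp add: X_def)
  have "w k / (t k - X) \<ge> - (w k / (1 + a * total_weight))" if k: "k < r" for k
  proof -
    have "w k / (X - t k) \<le> w k / (1 + a * total_weight)"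
      by (rule divide_left_mono) (use dist[OF k] aW weight_pos[OF k] in auto)
    moreover have "w k / (t k - X) = - (w k / (X - t k))"
      by (metis minus_diff_eq divide_minus_right)
    ultimately show ?thesis
      by simp
  qed
  then have "(\<Sum>k<r. w k / (t k - X)) \<ge> - (total_weight / (1 + a * total_weight))"
    using sum_mono[of "{..<r}" "\<lambda>k. - (w k / (1 + a * total_weight))"]
    by (simp add: total_weight_def sum_negf sum_divide_distrib)
  then have "a * (\<Sum>k<r. w k / (t k - X)) \<ge> - (a * total_weight / (1 + a * total_weight))"
    using mult_left_mono[of _ _ a] a by fastforce
  moreover have "1 - a * total_weight / (1 + a * total_weight) > 0"
    using aW by (simp add: field_simps)
  ultimately have "secular_fun X > 0"
    unfolding secular_fun_def by linarith
  moreover have "(\<Prod>k<r. X - t k) > 0"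
    by (rule prod_pos) (use dist aW in force)
  moreover have "X \<notin> t ` {..<r}"
    using dist aW by force
  ultimately show ?thesis
    using poly_secular_poly_eq unfolding X_def by simp
qed

lemma secular_poly_sign_left:
  assumes a: "a < 0" and r: "r > 0"
  shows "(-1) ^ r * poly secular_poly (t 0 - 1 + a * total_weight) > 0"
proof -
  define X where "X = t 0 - 1 + a * total_weight"
  have aW: "a * total_weight \<le> 0"
    using a total_weight_nonneg by (simp add: mult_nonpos_nonneg)
  have dist: "t k - X \<ge> 1 - a * total_weight" if "k < r" for k
    using mono_le[of 0 k] that by (simp add: X_def)
  have "w k / (t k - X) \<le> w k / (1 - a * total_weight)" if k: "k < r" for k
    by (rule divide_left_mono) (use dist[OF k] aW weight_pos[OF k] in auto)
  then have "(\<Sum>k<r. w k / (t k - X)) \<le> total_weight / (1 - a * total_weight)"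
    using sum_mono[of "{..<r}" _ "\<lambda>k. w k / (1 - a * total_weight)"]
    by (simp add: total_weight_def sum_divide_distrib)
  then have "a * (\<Sum>k<r. w k / (t k - X)) \<ge> a * total_weight / (1 - a * total_weight)"
    using mult_left_mono_neg[of _ _ a] a by fastforce
  moreover have "1 + a * total_weight / (1 - a * total_weight) > 0"
    using aW by (simp add: field_simps)
  ultimately have "secular_fun X > 0"
    unfolding secular_fun_def by linarith
  moreover have "(-1) ^ r * (\<Prod>k<r. X - t k) = (\<Prod>k<r. t k - X)"
    using prod_uminus[of "\<lambda>k. t k - X" "{..<r}"] by (simp flip: power_mult_distrib)
  moreover have "(\<Prod>k<r. t k - X) > 0"
    by (rule prod_pos) (use dist aW in force)
  moreover have "X \<notin> t ` {..<r}"
    using dist aW by force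
  ultimately show ?thesis
    using poly_secular_poly_eq[of X] unfolding X_def by (simp add: mult.assoc[symmetric])
qed

lemma secular_poly_monic:
  "degree secular_poly \<le> r \<and> coeff secular_poly r = 1"
proof -
  have prod: "degree (\<Prod>k<r. [:- t k, 1:]) = r \<and> coeff (\<Prod>k<r. [:- t k, 1:]) r = 1"
    using degree_prod_monic[of r "\<lambda>k. [:- t k, 1:]"] by (simp add: lessThan_atLeast0)
  define R where "R = Polynomial.smult a (\<Sum>k<r. Polynomial.smult (w k) (\<Prod>i\<in>{..<r} - {k}. [:- t i, 1:]))"
  have deg: "degree (\<Prod>i\<in>{..<r} - {k}. [:- t i, 1:]) < r" if "k < r" for k
    using degree_prod_sum_le[of "{..<r} - {k}" "\<lambda>i. [:- t i, 1:]"] that by (simp add: o_def)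
  have "coeff R r = 0"
    unfolding R_def by (auto simp: coeff_sum intro!: sum.neutral coeff_eq_0 dest: deg)
  moreover have "degree R \<le> r"
    unfolding R_def by (rule degree_le) (auto simp: coeff_sum intro!: sum.neutral coeff_eq_0 less_trans[OF deg])
  moreover have "secular_poly = (\<Prod>k<r. [:- t k, 1:]) - R"
    by (simp add: secular_poly_def R_def)
  ultimately show ?thesis
    using prod degree_diff_le[of "\<Prod>k<r. [:- t k, 1:]" r R] by simp
qed

lemma roots_from_intervals:
  fixes lo hi :: "nat \<Rightarrow> real"
  assumes intervals: "\<And>k. k < r \<Longrightarrow> lo k < hi k \<and> poly secular_poly (lo k) * poly secular_poly (hi k) < 0"
    and disjoint: "\<And>i j. i < j \<Longrightarrow> j < r \<Longrightarrow> hi i \<le> lo j"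
  shows "\<exists>m. (\<forall>k<r. lo k < m k \<and> m k < hi k) \<and> (\<forall>i j. i < j \<longrightarrow> j < r \<longrightarrow> m i < m j)
     \<and> secular_poly = (\<Prod>k<r. [:- m k, 1:])"
proof -
  define m where "m k = (SOME z. lo k < z \<and> z < hi k \<and> poly secular_poly z = 0)" for k
  have m: "lo k < m k \<and> m k < hi k \<and> poly secular_poly (m k) = 0" if "k < r" for k
    unfolding m_def by (rule someI_ex) (use poly_IVT intervals[OF that] in blast)
  have m_mono: "m i < m j" if "i < j" "j < r" for i j
    using m[of i] m[of j] disjoint[OF that] that by (meson less_le_trans less_trans)
  then have "inj_on m {..<r}"
    by (intro inj_onI) (metis lessThan_iff nat_neq_iff less_irrefl)
  then have card: "card (m ` {..<r}) = r"
    by (simp add: card_image)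
  have prod: "degree (\<Prod>k<r. [:- m k, 1:]) = r \<and> coeff (\<Prod>k<r. [:- m k, 1:]) r = 1"
    using degree_prod_monic[of r "\<lambda>k. [:- m k, 1:]"] by (simp add: lessThan_atLeast0)
  have "secular_poly = (\<Prod>k<r. [:- m k, 1:])"
  proof (rule poly_eqI_degree_lead_coeff[of _ r _ "m ` {..<r}"])
    fix z assume "z \<in> m ` {..<r}"
    then obtain k where k: "k < r" "z = m k"
      by auto
    then have "poly (\<Prod>k<r. [:- m k, 1:]) z = 0"
      by (auto simp: poly_prod intro!: prod_zero)
    then show "poly secular_poly z = poly (\<Prod>k<r. [:- m k, 1:]) z"
      using m[OF k(1)] k by simp
  qed (use prod secular_poly_monic card in simp_all)
  then show ?thesis
    using m m_mono by blast
qed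

lemma roots_interlace_pos:
  assumes a: "a > 0" and r: "r > 0"
  shows "\<exists>m. (\<forall>i j. i < j \<longrightarrow> j < r \<longrightarrow> m i < m j) \<and> secular_poly = (\<Prod>k<r. [:- m k, 1:])
     \<and> (\<forall>k<r. t k < m k \<and> (Suc k < r \<longrightarrow> m k < t (Suc k)))"
proof -
  define X where "X = t (r - 1) + 1 + a * total_weight"
  define hi where "hi k = (if Suc k < r then t (Suc k) else X)" for k
  have last: "poly secular_poly (t (r - 1)) < 0"
    using sign_secular_poly_at[of "r - 1"] r a by (simp add: mult_less_0_iff)
  have "t k < hi k \<and> poly secular_poly (t k) * poly secular_poly (hi k) < 0" if k: "k < r" for k
  proof (cases "Suc k < r")
    case True
    then show ?thesis
      using sign_change_secular_poly mono[of k "Suc k"] by (simp add: hi_def)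
  next
    case False
    then have k: "k = r - 1" and "hi k = X"
      using k by (simp_all add: hi_def)
    moreover have "a * total_weight \<ge> 0"
      using a total_weight_nonneg by simp
    ultimately show ?thesis
      using last secular_poly_pos_right[OF a r] by (simp add: X_def mult_neg_pos)
  qed
  moreover have "hi i \<le> t j" if "i < j" "j < r" for i j
    using that mono_le[of "Suc i" j] by (simp add: hi_def)
  ultimately obtain m where "\<forall>k<r. t k < m k \<and> m k < hi k" "\<forall>i j. i < j \<longrightarrow> j < r \<longrightarrow> m i < m j"
    "secular_poly = (\<Prod>k<r. [:- m k, 1:])"
    using roots_from_intervals[of t hi] by blast
  then show ?thesis
    by (intro exI[of _ m]) (auto simp: hi_def)
qed

lemma roots_interlace_neg:
  assumes a: "a < 0" and r: "r > 0"
  shows "\<exists>m. (\<forall>i j. i < j \<longrightarrow> j < r \<longrightarrow> m i < m j) \<and> secular_poly = (\<Prod>k<r. [:- m k, 1:])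
     \<and> (\<forall>k<r. m k < t k \<and> (Suc k < r \<longrightarrow> t k < m (Suc k)))"
proof -
  define X where "X = t 0 - 1 + a * total_weight"
  define lo where "lo k = (if k = 0 then X else t (k - 1))" for k
  have "(-1) ^ (r - 1) * poly secular_poly (t 0) > 0"
    using sign_secular_poly_at[of 0] r a by (simp add: mult_less_0_iff)
  moreover have "(-1) ^ r * poly secular_poly X > 0"
    using secular_poly_sign_left[OF a r] by (simp add: X_def)
  ultimately have "0 < ((-1) ^ r * poly secular_poly X) * ((-1) ^ (r - 1) * poly secular_poly (t 0))"
    by simp
  also have "\<dots> = ((-1) ^ r * (-1) ^ (r - 1)) * (poly secular_poly X * poly secular_poly (t 0))"
    by (simp add: mult_ac)
  also have "(-1 :: real) ^ r * (-1) ^ (r - 1) = -1"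
    using r by (cases r) auto
  finally have first: "poly secular_poly X * poly secular_poly (t 0) < 0"
    by simp
  have "lo k < t k \<and> poly secular_poly (lo k) * poly secular_poly (t k) < 0" if k: "k < r" for k
  proof (cases k)
    case 0
    moreover have "a * total_weight \<le> 0"
      using a total_weight_nonneg by (simp add: mult_nonpos_nonneg)
    ultimately show ?thesis
      using first by (simp add: lo_def X_def)
  next
    case (Suc k')
    then show ?thesis
      using sign_change_secular_poly[of k'] mono[of k' "Suc k'"] k by (simp add: lo_def)
  qed
  moreover have "t i \<le> lo j" if "i < j" "j < r" for i j
    using that mono_le[of i "j - 1"] by (simp add: lo_def)
  ultimately obtain m where "\<forall>k<r. lo k < m k \<and> m k < t k" "\<forall>i j. i < j \<longrightarrow> j < r \<longrightarrow> m i < m j"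
    "secular_poly = (\<Prod>k<r. [:- m k, 1:])"
    using roots_from_intervals[of lo t] by blast
  then show ?thesis
    by (intro exI[of _ m]) (auto simp: lo_def)
qed

lemma secular_fun_eq_0_iff:
  "x \<notin> t ` {..<r} \<and> secular_fun x = 0 \<longleftrightarrow> poly secular_poly x = 0"
proof (cases "x \<in> t ` {..<r}")
  case True
  then show ?thesis
    using secular_poly_nonzero_at by auto
next
  case False
  moreover have "(\<Prod>k<r. x - t k) \<noteq> 0"
    using False by auto
  ultimately show ?thesis
    using poly_secular_poly_eq[OF False] by simp
qed

lemma secular_poly_factorization:
  assumes r: "r > 0"
  shows "\<exists>m. (\<forall>i j. i < j \<longrightarrow> j < r \<longrightarrow> m i < m j) \<and> secular_poly = (\<Prod>k<r. [:- m k, 1:])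
     \<and> (a > 0 \<longrightarrow> (\<forall>k<r. t k < m k \<and> (Suc k < r \<longrightarrow> m k < t (Suc k))))
     \<and> (a < 0 \<longrightarrow> (\<forall>k<r. m k < t k \<and> (Suc k < r \<longrightarrow> t k < m (Suc k))))"
proof (cases "a > 0")
  case True
  then show ?thesis
    using roots_interlace_pos[OF True r] by auto
next
  case False
  then have "a < 0"
    using nonzero by simp
  then show ?thesis
    using roots_interlace_neg[OF _ r] by auto
qed

lemma secular_roots:
  "\<exists>m. (\<forall>i j. i < j \<longrightarrow> j < r \<longrightarrow> m i < m j)
     \<and> {x. x \<notin> t ` {..<r} \<and> secular_fun x = 0} = m ` {..<r}
     \<and> (\<forall>x. x \<notin> t ` {..<r} \<longrightarrow> (\<Prod>k<r. m k - x) = (\<Prod>k<r. t k - x) * secular_fun x)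
     \<and> (a > 0 \<longrightarrow> (\<forall>k<r. t k < m k \<and> (Suc k < r \<longrightarrow> m k < t (Suc k))))
     \<and> (a < 0 \<longrightarrow> (\<forall>k<r. m k < t k \<and> (Suc k < r \<longrightarrow> t k < m (Suc k))))"
proof (cases "r = 0")
  case True
  then show ?thesis
    unfolding secular_fun_def by simp
next
  case False
  then obtain m where mono_m: "\<forall>i j. i < j \<longrightarrow> j < r \<longrightarrow> m i < m j"
    and factor: "secular_poly = (\<Prod>k<r. [:- m k, 1:])"
    and interlace: "a > 0 \<longrightarrow> (\<forall>k<r. t k < m k \<and> (Suc k < r \<longrightarrow> m k < t (Suc k)))"
      "a < 0 \<longrightarrow> (\<forall>k<r. m k < t k \<and> (Suc k < r \<longrightarrow> t k < m (Suc k)))"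
    using secular_poly_factorization by blast
  have poly_m: "poly secular_poly x = (\<Prod>k<r. x - m k)" for x
    by (simp add: factor poly_prod)
  have "{x. x \<notin> t ` {..<r} \<and> secular_fun x = 0} = {x. poly secular_poly x = 0}"
    using secular_fun_eq_0_iff by blast
  also have "\<dots> = m ` {..<r}"
    unfolding poly_m by (auto simp: prod_zero_iff)
  finally have roots: "{x. x \<notin> t ` {..<r} \<and> secular_fun x = 0} = m ` {..<r}" .
  have "\<forall>x. x \<notin> t ` {..<r} \<longrightarrow> (\<Prod>k<r. m k - x) = (\<Prod>k<r. t k - x) * secular_fun x"
  proof (intro allI impI)
    fix x assume x: "x \<notin> t ` {..<r}"
    have "(\<Prod>k<r. m k - x) = (-1) ^ r * poly secular_poly x"
      using prod_uminus[of "\<lambda>k. x - m k" "{..<r}"] by (simp add: poly_m)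
    also have "\<dots> = (-1) ^ r * (\<Prod>k<r. x - t k) * secular_fun x"
      by (simp add: poly_secular_poly_eq[OF x])
    also have "(-1) ^ r * (\<Prod>k<r. x - t k) = (\<Prod>k<r. t k - x)"
      using prod_uminus[of "\<lambda>k. t k - x" "{..<r}"] by simp
    finally show "(\<Prod>k<r. m k - x) = (\<Prod>k<r. t k - x) * secular_fun x" .
  qed
  then show ?thesis
    using mono_m roots interlace by (intro exI[of _ m] conjI) assumption+
qed

end

lemma sorted_list_of_set_nth_less:
  "finite T \<Longrightarrow> i < j \<Longrightarrow> j < card T \<Longrightarrow> sorted_list_of_set T ! i < sorted_list_of_set T ! j"
  using strict_sorted_list_of_set[of T] by (simp add: sorted_wrt_iff_nth_less)

lemma image_nth_sorted_list_of_set: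
  assumes "finite T"
  shows "(\<lambda>k. sorted_list_of_set T ! k) ` {..<card T} = T"
proof -
  have "(\<lambda>k. sorted_list_of_set T ! k) ` {..<card T} = set (sorted_list_of_set T)"
    by (auto simp: set_conv_nth)
  then show ?thesis
    using assms by simp
qed

lemma sum_sorted_list_of_set:
  assumes "finite T"
  shows "(\<Sum>x\<in>T. g x) = (\<Sum>k<card T. g (sorted_list_of_set T ! k))"
proof -
  have "(\<Sum>x\<in>T. g x) = sum_list (map g (sorted_list_of_set T))"
    using assms by (metis sum.distinct_set_conv_list distinct_sorted_list_of_set set_sorted_list_of_set)
  then show ?thesis
    by (simp add: sum_list_sum_nth atLeast0LessThan)
qed

lemma sorted_list_of_set_image_strict_mono:
  assumes "\<And>i j. i < j \<Longrightarrow> j < r \<Longrightarrow> m i < m j"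
  shows "sorted_list_of_set (m ` {..<r}) = map m [0..<r]"
proof -
  have "inj_on m {..<r}"
    using assms by (intro inj_onI) (metis lessThan_iff nat_neq_iff less_irrefl)
  then have "sorted_wrt (<) (map m [0..<r]) \<and> set (map m [0..<r]) = m ` {..<r}
      \<and> length (map m [0..<r]) = card (m ` {..<r})"
    using assms by (auto simp: sorted_wrt_iff_nth_less card_image)
  then show ?thesis
    by (simp only: sorted_list_of_set_unique[symmetric] finite_imageI finite_lessThan)
qed

section \<open>Main angles and main eigenvalues\<close>

lemma main_eigenvalues_0: "main_eigenvalues 0 A = {}"
  by (simp add: main_eigenvalues_def main_angle_def)

lemma ones_vec_carrier [simp]: "ones_vec n \<in> carrier_vec n"
  by (simp add: ones_vec_def)

lemma dim_ones_vec [simp]: "dim_vec (ones_vec n) = n"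
  by (simp add: ones_vec_def)

lemma cinner_ones_vec_right: "cinner n u (ones_vec n) = (\<Sum>k<n. u $ k)"
  by (simp add: cinner_def ones_vec_def)

context hermitian
begin

definition main_vec :: "real \<Rightarrow> complex vec" where
  "main_vec \<theta> = eig_proj n A (of_real \<theta>) *\<^sub>v ones_vec n"

text \<open>\<open>main_weight \<theta>\<close> is \<open>n \<beta>\<^sup>2\<close> for the main angle \<open>\<beta>\<close> of \<open>\<theta>\<close>.\<close>

definition main_weight :: "real \<Rightarrow> real" where
  "main_weight \<theta> = Re (cinner n (main_vec \<theta>) (main_vec \<theta>))"

lemma main_weight_nonneg: "main_weight \<theta> \<ge> 0"
  by (simp add: main_weight_def cinner_self sum_nonneg)

lemma main_weight_eq_main_angle: "main_weight \<theta> = real n * (main_angle n A \<theta>)\<^sup>2"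
proof (cases "n = 0")
  case True
  then show ?thesis
    unfolding main_weight_def cinner_def main_angle_def by simp
next
  case False
  have "main_angle n A \<theta> = 1 / sqrt (real n) * sqrt (main_weight \<theta>)"
    unfolding main_angle_def Let_def main_vec_def[symmetric] main_weight_def cinner_def
    by (simp add: mult.commute)
  then show ?thesis
    using False main_weight_nonneg[of \<theta>] by (simp add: power_mult_distrib power_divide)
qed

lemma main_vec_carrier [simp]: "\<theta> \<in> eigvals \<Longrightarrow> main_vec \<theta> \<in> carrier_vec n"
  by (simp add: main_vec_def)

lemma dim_main_vec [simp]: "\<theta> \<in> eigvals \<Longrightarrow> dim_vec (main_vec \<theta>) = n"
  using main_vec_carrier carrier_vecD by blast

lemma eigenvector_main_vec: "\<theta> \<in> eigvals \<Longrightarrow> A *\<^sub>v main_vec \<theta> = of_real \<theta> \<cdot>\<^sub>v main_vec \<theta>"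
  unfolding main_vec_def by (rule eig_proj_eigenvector) simp_all

text \<open>Since \<open>E\<close> is a Hermitian idempotent, \<open>(E j)\<^sup>* (E j) = j\<^sup>* E j\<close>.\<close>

lemma cinner_main_vec:
  assumes \<theta>: "\<theta> \<in> eigvals"
  shows "cinner n (main_vec \<theta>) (main_vec \<theta>) = of_real (main_weight \<theta>)"
    and "cinner n (main_vec \<theta>) (ones_vec n) = of_real (main_weight \<theta>)"
    and "cinner n (ones_vec n) (main_vec \<theta>) = of_real (main_weight \<theta>)"
proof -
  have j: "ones_vec n \<in> carrier_vec n"
    by simp
  show self: "cinner n (main_vec \<theta>) (main_vec \<theta>) = of_real (main_weight \<theta>)"
    by (simp add: main_weight_def cinner_self)
  have "cinner n (main_vec \<theta>) (main_vec \<theta>) = cinner n (ones_vec n) (main_vec \<theta>)"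
    using cinner_eig_proj[OF \<theta> j, of "main_vec \<theta>"] eig_proj_idem[OF \<theta> j] \<theta>
    by (simp add: main_vec_def)
  then show ones: "cinner n (ones_vec n) (main_vec \<theta>) = of_real (main_weight \<theta>)"
    using self by simp
  show "cinner n (main_vec \<theta>) (ones_vec n) = of_real (main_weight \<theta>)"
    using arg_cong[OF ones, of cnj] by (simp add: cnj_cinner)
qed

lemma main_weight_eq_0_iff: "\<theta> \<in> eigvals \<Longrightarrow> main_weight \<theta> = 0 \<longleftrightarrow> main_vec \<theta> = 0\<^sub>v n"
  using cinner_main_vec(1) cinner_self_eq_0_iff[OF main_vec_carrier] by fastforce

lemma main_eigenvalues_eq:
  assumes "n > 0"
  shows "main_eigenvalues n A = {\<theta> \<in> eigvals. main_weight \<theta> \<noteq> 0}"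
  using assms by (auto simp: main_eigenvalues_def eigvals_def main_weight_eq_main_angle)

lemma finite_main_eigenvalues: "finite (main_eigenvalues n A)"
  by (cases "n = 0") (auto simp: main_eigenvalues_0 main_eigenvalues_eq finite_eigvals)

lemma sum_main_vec:
  assumes i: "i < n"
  shows "(\<Sum>\<theta>\<in>main_eigenvalues n A. main_vec \<theta> $ i) = 1"
proof -
  have "(\<Sum>\<theta>\<in>main_eigenvalues n A. main_vec \<theta> $ i) = (\<Sum>\<theta>\<in>eigvals. main_vec \<theta> $ i)"
    using i main_weight_eq_0_iff
    by (intro sum.mono_neutral_left finite_eigvals) (auto simp: main_eigenvalues_eq)
  also have "\<dots> = 1"
    using sum_eig_proj_mult_vec[of "ones_vec n" i] i by (simp add: main_vec_def ones_vec_def)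
  finally show ?thesis .
qed

lemma cinner_ones_vec_sum_main_vec:
  "cinner n w (ones_vec n) = (\<Sum>\<theta>\<in>main_eigenvalues n A. cinner n w (main_vec \<theta>))"
proof -
  have "cinner n w (ones_vec n) = (\<Sum>i<n. w $ i * cnj (\<Sum>\<theta>\<in>main_eigenvalues n A. main_vec \<theta> $ i))"
    unfolding cinner_def by (intro sum.cong refl) (simp add: sum_main_vec ones_vec_def)
  also have "\<dots> = (\<Sum>\<theta>\<in>main_eigenvalues n A. cinner n w (main_vec \<theta>))"
    unfolding cinner_def cnj_sum sum_distrib_left by (rule sum.swap)
  finally show ?thesis .
qed

end

section \<open>Perturbing by a multiple of the all-ones matrix\<close>

locale ones_perturbation = hermitian +
  fixes a :: real
  assumes dim_pos: "n > 0" and nonzero: "a \<noteq> 0"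
begin

definition M :: "complex mat" where
  "M = A + complex_of_real a \<cdot>\<^sub>m ones_mat n"

lemma M_carrier [simp]: "M \<in> carrier_mat n n"
  by (simp add: M_def ones_mat_def)

lemma hermitian_M: "hermitian_mat n M"
proof -
  have "cnj (A $$ (j, i)) = A $$ (i, j)" if "i < n" "j < n" for i j
    using hermitian that by (metis hermitian_mat_def ctrans_def index_mat(1) dim case_prod_conv)
  then show ?thesis
    by (auto simp: hermitian_mat_def M_def ctrans_def ones_mat_def intro!: eq_matI)
qed

sublocale M: hermitian n M
  by unfold_locales (rule hermitian_M)

lemma mult_vec_M:
  assumes v: "v \<in> carrier_vec n"
  shows "M *\<^sub>v v = A *\<^sub>v v + (of_real a * (\<Sum>k<n. v $ k)) \<cdot>\<^sub>v ones_vec n"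
proof (rule eq_vecI)
  fix i assume "i < dim_vec (A *\<^sub>v v + (of_real a * (\<Sum>k<n. v $ k)) \<cdot>\<^sub>v ones_vec n)"
  then have i: "i < n"
    by (simp add: ones_vec_def)
  have "(M *\<^sub>v v) $ i = (\<Sum>k<n. (A $$ (i,k) + of_real a) * v $ k)"
    using mult_mat_vec_index_sum[OF M_carrier v i] i by (simp add: M_def ones_mat_def)
  also have "\<dots> = (A *\<^sub>v v) $ i + of_real a * (\<Sum>k<n. v $ k)"
    using mult_mat_vec_index_sum[OF carrier v i]
    by (simp add: distrib_right sum.distrib sum_distrib_left)
  finally show "(M *\<^sub>v v) $ i = (A *\<^sub>v v + (of_real a * (\<Sum>k<n. v $ k)) \<cdot>\<^sub>v ones_vec n) $ i"
    using i v by (simp add: ones_vec_def)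
qed (simp add: ones_vec_def)

definition secular :: "real \<Rightarrow> real" where
  "secular x = 1 + a * (\<Sum>\<theta>\<in>main_eigenvalues n A. main_weight \<theta> / (\<theta> - x))"

lemma cinner_M_eigenvector_main_vec:
  assumes w: "w \<in> carrier_vec n" "M *\<^sub>v w = of_real \<mu> \<cdot>\<^sub>v w" and \<theta>: "\<theta> \<in> eigvals"
  shows "of_real (\<mu> - \<theta>) * cinner n w (main_vec \<theta>) =
    of_real a * cinner n w (ones_vec n) * of_real (main_weight \<theta>)"
proof -
  define s where "s = cinner n w (ones_vec n)"
  have E: "main_vec \<theta> \<in> carrier_vec n"
    using \<theta> by simp
  have j: "ones_vec n \<in> carrier_vec n"
    by (simp add: ones_vec_def)
  have "of_real \<mu> * cinner n w (main_vec \<theta>) = cinner n (M *\<^sub>v w) (main_vec \<theta>)"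
    using w by (simp add: cinner_smult_left)
  also have "\<dots> = cinner n (A *\<^sub>v w) (main_vec \<theta>) + of_real a * s * cinner n (ones_vec n) (main_vec \<theta>)"
    using w(1) j by (simp add: mult_vec_M cinner_add_left cinner_smult_left s_def cinner_ones_vec_right)
  also have "cinner n (A *\<^sub>v w) (main_vec \<theta>) = of_real \<theta> * cinner n w (main_vec \<theta>)"
    using cinner_self_adjoint[OF w(1) E] eigenvector_main_vec[OF \<theta>] E by (simp add: cinner_smult_right)
  finally show ?thesis
    using cinner_main_vec(3)[OF \<theta>] by (simp add: s_def algebra_simps)
qed

lemma main_eigenvalue_M_secular_root:
  assumes \<mu>: "\<mu> \<in> main_eigenvalues n M"
  shows "\<mu> \<notin> main_eigenvalues n A \<and> secular \<mu> = 0"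
proof -
  have \<mu>M: "\<mu> \<in> M.eigvals" and "M.main_weight \<mu> \<noteq> 0"
    using \<mu> by (auto simp: M.main_eigenvalues_eq[OF dim_pos])
  define w where "w = M.main_vec \<mu>"
  have w: "w \<in> carrier_vec n" "M *\<^sub>v w = of_real \<mu> \<cdot>\<^sub>v w"
    using M.eigenvector_main_vec[OF \<mu>M] \<mu>M by (simp_all add: w_def)
  define s where "s = cinner n w (ones_vec n)"
  have s: "s = of_real (M.main_weight \<mu>)" "s \<noteq> 0"
    using M.cinner_main_vec(2)[OF \<mu>M] \<open>M.main_weight \<mu> \<noteq> 0\<close> by (simp_all add: s_def w_def)
  have comp: "of_real (\<mu> - \<theta>) * cinner n w (main_vec \<theta>) = of_real a * s * of_real (main_weight \<theta>)"
    if "\<theta> \<in> main_eigenvalues n A" for \<theta>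
    using cinner_M_eigenvector_main_vec[OF w] that by (simp add: s_def main_eigenvalues_eq[OF dim_pos])
  have notin: "\<mu> \<notin> main_eigenvalues n A"
    using comp[of \<mu>] nonzero s(2) by (auto simp: main_eigenvalues_eq[OF dim_pos])
  have "s = (\<Sum>\<theta>\<in>main_eigenvalues n A. cinner n w (main_vec \<theta>))"
    unfolding s_def by (rule cinner_ones_vec_sum_main_vec)
  also have "\<dots> = (\<Sum>\<theta>\<in>main_eigenvalues n A. - (of_real a * s) * of_real (main_weight \<theta> / (\<theta> - \<mu>)))"
  proof (intro sum.cong refl)
    fix \<theta> assume \<theta>: "\<theta> \<in> main_eigenvalues n A"
    then have "complex_of_real (\<mu> - \<theta>) \<noteq> 0"
      using notin by auto
    then show "cinner n w (main_vec \<theta>) = - (of_real a * s) * of_real (main_weight \<theta> / (\<theta> - \<mu>))"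
      using comp[OF \<theta>] by (simp add: field_simps)
  qed
  also have "\<dots> = - (of_real a * s) * of_real (\<Sum>\<theta>\<in>main_eigenvalues n A. main_weight \<theta> / (\<theta> - \<mu>))"
    by (simp add: sum_distrib_left)
  finally have s_eq: "s = - (of_real a * s) * of_real (\<Sum>\<theta>\<in>main_eigenvalues n A. main_weight \<theta> / (\<theta> - \<mu>))" .
  have "s * of_real (secular \<mu>) =
      s - - (of_real a * s) * of_real (\<Sum>\<theta>\<in>main_eigenvalues n A. main_weight \<theta> / (\<theta> - \<mu>))"
    by (simp add: secular_def algebra_simps)
  also have "\<dots> = 0"
    by (metis s_eq diff_self)
  finally have "s * of_real (secular \<mu>) = 0" .
  then show ?thesis
    using notin s(2) by simp
qed

text \<open>The vector \<open>(A - \<mu>)\<^sup>-\<^sup>1 j\<close>, written through the spectral decomposition of \<open>j\<close>.\<close>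

definition resolvent_vec :: "real \<Rightarrow> complex vec" where
  "resolvent_vec \<mu> = vec n (\<lambda>i. \<Sum>\<theta>\<in>main_eigenvalues n A. main_vec \<theta> $ i / of_real (\<theta> - \<mu>))"

lemma resolvent_vec_carrier [simp]: "resolvent_vec \<mu> \<in> carrier_vec n"
  by (simp add: resolvent_vec_def)

lemma dim_resolvent_vec [simp]: "dim_vec (resolvent_vec \<mu>) = n"
  by (simp add: resolvent_vec_def)

lemma sum_resolvent_vec:
  "(\<Sum>k<n. resolvent_vec \<mu> $ k) = of_real (\<Sum>\<theta>\<in>main_eigenvalues n A. main_weight \<theta> / (\<theta> - \<mu>))"
proof -
  have "(\<Sum>k<n. resolvent_vec \<mu> $ k) =
      (\<Sum>\<theta>\<in>main_eigenvalues n A. cinner n (main_vec \<theta>) (ones_vec n) / of_real (\<theta> - \<mu>))"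
    by (simp add: resolvent_vec_def cinner_ones_vec_right sum_divide_distrib sum.swap[of _ "{..<n}"])
  also have "\<dots> = of_real (\<Sum>\<theta>\<in>main_eigenvalues n A. main_weight \<theta> / (\<theta> - \<mu>))"
    by (simp add: cinner_main_vec(2) main_eigenvalues_eq[OF dim_pos])
  finally show ?thesis .
qed

lemma mult_vec_resolvent_vec:
  assumes \<mu>: "\<mu> \<notin> main_eigenvalues n A"
  shows "A *\<^sub>v resolvent_vec \<mu> = of_real \<mu> \<cdot>\<^sub>v resolvent_vec \<mu> + ones_vec n"
proof (rule eq_vecI)
  fix i assume "i < dim_vec (of_real \<mu> \<cdot>\<^sub>v resolvent_vec \<mu> + ones_vec n)"
  then have i: "i < n"
    by simp
  have E: "\<theta> \<in> main_eigenvalues n A \<Longrightarrow> main_vec \<theta> \<in> carrier_vec n" for \<theta>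
    by (simp add: main_eigenvalues_eq[OF dim_pos])
  have "(A *\<^sub>v resolvent_vec \<mu>) $ i =
      (\<Sum>\<theta>\<in>main_eigenvalues n A. (A *\<^sub>v main_vec \<theta>) $ i / of_real (\<theta> - \<mu>))"
    using i E by (simp add: mult_mat_vec_index_sum[OF carrier] resolvent_vec_def sum_distrib_left
        sum_divide_distrib sum.swap[of _ "main_eigenvalues n A"] mult.assoc del: index_mult_mat_vec)
  also have "\<dots> = (\<Sum>\<theta>\<in>main_eigenvalues n A. of_real \<mu> * (main_vec \<theta> $ i / of_real (\<theta> - \<mu>)) + main_vec \<theta> $ i)"
  proof (intro sum.cong refl)
    fix \<theta> assume \<theta>: "\<theta> \<in> main_eigenvalues n A"
    have "(A *\<^sub>v main_vec \<theta>) $ i = of_real \<theta> * main_vec \<theta> $ i"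
      using \<theta> i E[OF \<theta>] eigenvector_main_vec[of \<theta>] by (auto simp: main_eigenvalues_eq[OF dim_pos])
    moreover have "complex_of_real (\<theta> - \<mu>) \<noteq> 0"
      using \<theta> \<mu> by auto
    ultimately show "(A *\<^sub>v main_vec \<theta>) $ i / of_real (\<theta> - \<mu>) =
        of_real \<mu> * (main_vec \<theta> $ i / of_real (\<theta> - \<mu>)) + main_vec \<theta> $ i"
      by (simp add: field_simps)
  qed
  also have "\<dots> = (of_real \<mu> \<cdot>\<^sub>v resolvent_vec \<mu> + ones_vec n) $ i"
    using i by (simp add: sum.distrib sum_distrib_left sum_main_vec resolvent_vec_def ones_vec_def)
  finally show "(A *\<^sub>v resolvent_vec \<mu>) $ i = (of_real \<mu> \<cdot>\<^sub>v resolvent_vec \<mu> + ones_vec n) $ i" .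
qed simp

lemma mult_vec_M_resolvent_vec:
  assumes \<mu>: "\<mu> \<notin> main_eigenvalues n A"
  shows "M *\<^sub>v resolvent_vec \<mu> = of_real \<mu> \<cdot>\<^sub>v resolvent_vec \<mu> + of_real (secular \<mu>) \<cdot>\<^sub>v ones_vec n"
proof -
  define s where "s = (\<Sum>\<theta>\<in>main_eigenvalues n A. main_weight \<theta> / (\<theta> - \<mu>))"
  have "M *\<^sub>v resolvent_vec \<mu> = A *\<^sub>v resolvent_vec \<mu> + (of_real a * of_real s) \<cdot>\<^sub>v ones_vec n"
    by (simp add: mult_vec_M s_def sum_resolvent_vec)
  also have "\<dots> = of_real \<mu> \<cdot>\<^sub>v resolvent_vec \<mu> + ones_vec n + (of_real a * of_real s) \<cdot>\<^sub>v ones_vec n"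
    by (simp add: mult_vec_resolvent_vec[OF \<mu>])
  also have "\<dots> = of_real \<mu> \<cdot>\<^sub>v resolvent_vec \<mu> + of_real (secular \<mu>) \<cdot>\<^sub>v ones_vec n"
    by (auto simp: secular_def s_def ones_vec_def intro!: eq_vecI)
  finally show ?thesis .
qed

lemma secular_root_main_eigenvalue_M:
  assumes \<mu>: "\<mu> \<notin> main_eigenvalues n A" and root: "secular \<mu> = 0"
  shows "\<mu> \<in> main_eigenvalues n M"
proof -
  define v where "v = resolvent_vec \<mu>"
  define s where "s = (\<Sum>\<theta>\<in>main_eigenvalues n A. main_weight \<theta> / (\<theta> - \<mu>))"
  have v: "v \<in> carrier_vec n"
    by (simp add: v_def)
  have "s \<noteq> 0"
    using root by (auto simp: secular_def s_def)
  have Mv: "M *\<^sub>v v = of_real \<mu> \<cdot>\<^sub>v v"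
    using mult_vec_M_resolvent_vec[OF \<mu>] root v by (auto simp: v_def intro!: eq_vecI)
  have sum_v: "cinner n v (ones_vec n) = of_real s"
    by (simp add: cinner_ones_vec_right v_def s_def sum_resolvent_vec)
  then have "v \<noteq> 0\<^sub>v n"
    using \<open>s \<noteq> 0\<close> by auto
  then have \<mu>M: "\<mu> \<in> M.eigvals"
    using v Mv by (auto simp: M.eigvals_def eigenvalue_def eigenvector_def)
  have "cinner n (M.main_vec \<mu>) v = cinner n (ones_vec n) v"
    using M.cinner_eig_proj[OF \<mu>M _ v] M.eig_proj_fixes_eigenvector[OF \<mu>M v Mv]
    by (simp add: M.main_vec_def)
  also have "\<dots> = of_real s"
    using sum_v cnj_cinner[of n v "ones_vec n"] by (metis complex_cnj_complex_of_real)
  finally have "M.main_vec \<mu> \<noteq> 0\<^sub>v n"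
    using \<open>s \<noteq> 0\<close> by auto
  then show ?thesis
    using \<mu>M M.main_weight_eq_0_iff M.main_eigenvalues_eq[OF dim_pos] by auto
qed

lemma main_eigenvalues_M:
  "main_eigenvalues n M = {x. x \<notin> main_eigenvalues n A \<and> secular x = 0}"
  using main_eigenvalue_M_secular_root secular_root_main_eigenvalue_M by blast

sublocale secular "card (main_eigenvalues n A)" "\<lambda>k. sorted_list_of_set (main_eigenvalues n A) ! k"
  "\<lambda>k. main_weight (sorted_list_of_set (main_eigenvalues n A) ! k)" a
proof
  let ?T = "main_eigenvalues n A"
  show "sorted_list_of_set ?T ! i < sorted_list_of_set ?T ! j" if "i < j" "j < card ?T" for i j
    using sorted_list_of_set_nth_less[OF finite_main_eigenvalues that] .
  show "main_weight (sorted_list_of_set ?T ! k) > 0" if "k < card ?T" for k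
    using image_nth_sorted_list_of_set[OF finite_main_eigenvalues] that main_weight_nonneg[of "sorted_list_of_set ?T ! k"]
    by (force simp: main_eigenvalues_eq[OF dim_pos])
qed (rule nonzero)

lemma secular_fun_eq: "secular_fun = secular"
  by (simp add: fun_eq_iff secular_fun_def secular_def sum_sorted_list_of_set[OF finite_main_eigenvalues])

lemma main_eigenvalues_interlace:
  defines "\<tau> \<equiv> sorted_list_of_set (main_eigenvalues n A)"
    and "\<mu> \<equiv> sorted_list_of_set (main_eigenvalues n M)"
    and "r \<equiv> card (main_eigenvalues n A)"
  shows "finite (main_eigenvalues n M) \<and> card (main_eigenvalues n M) = r
    \<and> (\<forall>x. x \<notin> main_eigenvalues n A \<longrightarrow> (\<Prod>i<r. \<mu> ! i - x) = (\<Prod>i<r. \<tau> ! i - x) * secular x)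
    \<and> (a > 0 \<longrightarrow> (\<forall>i<r. \<tau> ! i < \<mu> ! i \<and> (i + 1 < r \<longrightarrow> \<mu> ! i < \<tau> ! (i + 1))))
    \<and> (a < 0 \<longrightarrow> (\<forall>i<r. \<mu> ! i < \<tau> ! i \<and> (i + 1 < r \<longrightarrow> \<tau> ! i < \<mu> ! (i + 1))))"
proof -
  obtain m where mono_m: "\<forall>i j. i < j \<longrightarrow> j < r \<longrightarrow> m i < m j"
    and roots: "{x. x \<notin> main_eigenvalues n A \<and> secular x = 0} = m ` {..<r}"
    and prod: "\<forall>x. x \<notin> main_eigenvalues n A \<longrightarrow> (\<Prod>k<r. m k - x) = (\<Prod>k<r. \<tau> ! k - x) * secular x"
    and interlace: "a > 0 \<longrightarrow> (\<forall>k<r. \<tau> ! k < m k \<and> (Suc k < r \<longrightarrow> m k < \<tau> ! Suc k))"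
      "a < 0 \<longrightarrow> (\<forall>k<r. m k < \<tau> ! k \<and> (Suc k < r \<longrightarrow> \<tau> ! k < m (Suc k)))"
    using secular_roots[unfolded secular_fun_eq image_nth_sorted_list_of_set[OF finite_main_eigenvalues],
        folded \<tau>_def r_def]
    by (elim exE conjE) (rule that)
  have M: "main_eigenvalues n M = m ` {..<r}"
    using roots main_eigenvalues_M by simp
  have \<mu>: "\<mu> = map m [0..<r]"
    unfolding \<mu>_def M using mono_m by (simp add: sorted_list_of_set_image_strict_mono)
  have "card (main_eigenvalues n M) = r"
    using arg_cong[OF \<mu>, of length] \<mu>_def M by simp
  then show ?thesis
    using M \<mu> prod interlace by simp
qed

end

lemma main_eigenvalues_add_ones_trivial:
  assumes "hermitian_mat n H" and "n = 0 \<or> a = 0"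
  shows "main_eigenvalues n (H + complex_of_real a \<cdot>\<^sub>m ones_mat n) = main_eigenvalues n H"
proof (cases "n = 0")
  case False
  then have "H + complex_of_real a \<cdot>\<^sub>m ones_mat n = H"
    using assms by (intro eq_matI) (auto simp: hermitian_mat_def ones_mat_def)
  then show ?thesis
    by simp
qed (simp add: main_eigenvalues_0)

theorem theorem2p2:
  fixes n :: nat and H :: "complex mat" and a :: real
  assumes herm: "hermitian_mat n H"
  defines "M \<equiv> H + complex_of_real a \<cdot>\<^sub>m ones_mat n"
  defines "\<tau> \<equiv> sorted_list_of_set (main_eigenvalues n H)"
  defines "\<mu> \<equiv> sorted_list_of_set (main_eigenvalues n M)"
  defines "r \<equiv> card (main_eigenvalues n H)"
  defines "s \<equiv> card (main_eigenvalues n M)"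
  shows "finite (main_eigenvalues n H) \<and> finite (main_eigenvalues n M) \<and> r = s
    \<and> (\<forall>x::real. x \<notin> main_eigenvalues n H \<longrightarrow>
          (\<Prod>i<r. \<mu> ! i - x) =
          (\<Prod>i<r. \<tau> ! i - x) *
            (1 + a * (\<Sum>j<r. real n * (main_angle n H (\<tau> ! j))^2 / (\<tau> ! j - x))))
    \<and> (a > 0 \<longrightarrow> (\<forall>i<r. \<tau> ! i < \<mu> ! i \<and> (i + 1 < r \<longrightarrow> \<mu> ! i < \<tau> ! (i + 1))))
    \<and> (a < 0 \<longrightarrow> (\<forall>i<r. \<mu> ! i < \<tau> ! i \<and> (i + 1 < r \<longrightarrow> \<tau> ! i < \<mu> ! (i + 1))))"
proof (cases "n = 0 \<or> a = 0")
  case True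
  then show ?thesis
    using main_eigenvalues_add_ones_trivial[OF herm] hermitian.finite_main_eigenvalues[OF hermitian.intro[OF herm]]
    unfolding \<tau>_def \<mu>_def r_def s_def M_def by (auto simp: main_eigenvalues_0)
next
  case False
  then interpret P: ones_perturbation n H a
    by unfold_locales (auto simp: herm)
  have "P.secular x = 1 + a * (\<Sum>j<r. real n * (main_angle n H (\<tau> ! j))\<^sup>2 / (\<tau> ! j - x))" for x
    unfolding P.secular_def r_def \<tau>_def
    by (simp add: sum_sorted_list_of_set[OF P.finite_main_eigenvalues] P.main_weight_eq_main_angle)
  moreover have "M = P.M"
    by (simp add: M_def P.M_def)
  ultimately show ?thesis
    using P.main_eigenvalues_interlace P.finite_main_eigenvalues unfolding \<tau>_def \<mu>_def r_def s_def
    by simp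
qed

end
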